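(* Let $d\ge2$ and $\alpha\in[1,\infty)$. (i) (Sobolev's inequality) For all $f\in\mathcal{BV}_{\mathcal H_\alpha}(\mathbb R^d)$, $$\|f\|_{L^{d/(d-1)}}\lesssim\|\nabla_{\mathcal H_\alpha}f\|(\mathbb R^d).$$ (ii) (Isoperimetric inequality) Let $E$ be a bounded set of finite $\alpha$-Hermite perimeter in $\mathbb R^d$. Then $$|E|^{1-1/d}\lesssim P_{\mathcal H_\alpha}(E).$$ (iii) The two statements (i) and (ii) are equivalent.
   Context: $U\lesssim V$ means $U\le cV$ for a constant $c>0$ depending only on fixed parameters such as $d,\alpha$ (not on $f$ or $E$). $|E|$ is Lebesgue measure. For $i=1,\dots,d$ put $A^{\pm}_{i,\alpha}=\partial_{x_i}\pm\sqrt{\alpha-1}\,x_i|x|^{(\alpha-2)/2}$ (the second term acting by multiplication). For $\varphi=(\varphi_1,\dots,\varphi_{2d})\in C^1(\mathbb R^d;\mathbb R^{2d})$, $$\mathrm{div}_{\mathcal H_\alpha}\varphi=A^+_{d,\alpha}\varphi_1+\cdots+A^+_{1,\alpha}\varphi_d+A^-_{1,\alpha}\varphi_{d+1}+\cdots+A^-_{d,\alpha}\varphi_{2d}.$$ $\mathcal F(\mathbb R^d)$ is the class of $\varphi\in C^1_c(\mathbb R^d;\mathbb R^{2d})$ with $\sup_x(|\varphi_1(x)|^2+\cdots+|\varphi_{2d}(x)|^2)^{1/2}\le1$. The $\alpha$-Hermite variation of $f\in L^1(\mathbb R^d)$ is $\|\nabla_{\mathcal H_\alpha}f\|(\mathbb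 R^d)=\sup_{\varphi\in\mathcal F(\mathbb R^d)}\int f\,\mathrm{div}_{\mathcal H_\alpha}\varphi\,dx$; $\mathcal{BV}_{\mathcal H_\alpha}(\mathbb R^d)$ is the set of $f\in L^1(\mathbb R^d)$ for which it is finite. The $\alpha$-Hermite perimeter of a (measurable) set $E$ is $P_{\mathcal H_\alpha}(E)=\sup_{\varphi\in\mathcal F(\mathbb R^d)}\int_E\mathrm{div}_{\mathcal H_\alpha}\varphi\,dx$. *)

theory Defs
  imports "HOL-Analysis.Analysis"
begin

definition partial_deriv :: "'n::finite \<Rightarrow> (real^'n \<Rightarrow> real) \<Rightarrow> real^'n \<Rightarrow> real" where
  "partial_deriv i g x = deriv (\<lambda>t. g (x + t *\<^sub>R axis i 1)) 0"

text \<open>At the origin the factor \<open>x $ i\<close> vanishes, so the value that \<open>powr\<close> gives to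
  \<open>0 powr ((\<alpha> - 2) / 2)\<close> plays no role: for \<open>\<alpha> \<ge> 1\<close> the product is the continuous
  extension by \<open>0\<close>.\<close>

definition hermite_potential :: "real \<Rightarrow> 'n::finite \<Rightarrow> real^'n \<Rightarrow> real" where
  "hermite_potential \<alpha> i x = sqrt (\<alpha> - 1) * x $ i * norm x powr ((\<alpha> - 2) / 2)"

definition A_plus :: "real \<Rightarrow> 'n::finite \<Rightarrow> (real^'n \<Rightarrow> real) \<Rightarrow> real^'n \<Rightarrow> real" where
  "A_plus \<alpha> i g x = partial_deriv i g x + hermite_potential \<alpha> i x * g x"

definition A_minus :: "real \<Rightarrow> 'n::finite \<Rightarrow> (real^'n \<Rightarrow> real) \<Rightarrow> real^'n \<Rightarrow> real" where
  "A_minus \<alpha> i g x = partial_deriv i g x - hermite_potential \<alpha> i x * g x"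

text \<open>Vector fields with \<open>2d\<close> components are indexed by \<open>'n + 'n\<close>, where \<open>d = CARD('n)\<close>:
  the component \<open>Inl i\<close> is the one acted on by \<open>A_plus \<alpha> i\<close> (in the numbering
  \<open>1, \<dots>, 2d\<close> it is number \<open>d + 1 - i\<close>), and the component \<open>Inr i\<close> the one acted on by
  \<open>A_minus \<alpha> i\<close> (number \<open>d + i\<close>).\<close>

definition hermite_div ::
    "real \<Rightarrow> (real^'n::finite \<Rightarrow> real^('n + 'n)) \<Rightarrow> real^'n \<Rightarrow> real" where
  "hermite_div \<alpha> \<phi> x =
     (\<Sum>i\<in>UNIV. A_plus \<alpha> i (\<lambda>y. \<phi> y $ Inl i) x) +
     (\<Sum>i\<in>UNIV. A_minus \<alpha> i (\<lambda>y. \<phi> y $ Inr i) x)"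

definition C1_fun :: "('a::real_normed_vector \<Rightarrow> 'b::real_normed_vector) \<Rightarrow> bool" where
  "C1_fun \<phi> \<longleftrightarrow>
     (\<exists>\<phi>' :: 'a \<Rightarrow> 'a \<Rightarrow>\<^sub>L 'b.
        (\<forall>x. (\<phi> has_derivative blinfun_apply (\<phi>' x)) (at x)) \<and> continuous_on UNIV \<phi>')"

definition test_fields :: "(real^'n::finite \<Rightarrow> real^('n + 'n)) set" where
  "test_fields = {\<phi>. C1_fun \<phi> \<and> compact (closure {x. \<phi> x \<noteq> 0}) \<and> (\<forall>x. norm (\<phi> x) \<le> 1)}"

definition hermite_variation :: "real \<Rightarrow> (real^'n::finite \<Rightarrow> real) \<Rightarrow> ereal" where
  "hermite_variation \<alpha> f =
     (SUP \<phi>\<in>test_fields. ereal (LINT x|lebesgue. f x * hermite_div \<alpha> \<phi> x))"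

definition hermite_BV :: "real \<Rightarrow> (real^'n::finite \<Rightarrow> real) set" where
  "hermite_BV \<alpha> = {f. integrable lebesgue f \<and> hermite_variation \<alpha> f < \<infinity>}"

definition hermite_perimeter :: "real \<Rightarrow> (real^'n::finite) set \<Rightarrow> ereal" where
  "hermite_perimeter \<alpha> E =
     (SUP \<phi>\<in>test_fields. ereal (LINT x:E|lebesgue. hermite_div \<alpha> \<phi> x))"

text \<open>The norm is \<open>\<infinity>\<close> if \<open>f\<close> is not in the space, so that a bound on it
  includes membership.\<close>

definition Lp_norm :: "real \<Rightarrow> ('a::euclidean_space \<Rightarrow> real) \<Rightarrow> ereal" where
  "Lp_norm p f =
     (let I = (\<integral>\<^sup>+ x. ennreal (\<bar>f x\<bar> powr p) \<partial>lebesgue)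
      in if I = \<infinity> then \<infinity> else ereal (enn2real I powr (1 / p)))"

definition sobolev_inequality :: "'n::finite itself \<Rightarrow> real \<Rightarrow> bool" where
  "sobolev_inequality _ \<alpha> \<longleftrightarrow>
     (\<exists>c>0. \<forall>f \<in> (hermite_BV \<alpha> :: (real^'n \<Rightarrow> real) set).
        Lp_norm (real CARD('n) / (real CARD('n) - 1)) f \<le> ereal c * hermite_variation \<alpha> f)"

definition isoperimetric_inequality :: "'n::finite itself \<Rightarrow> real \<Rightarrow> bool" where
  "isoperimetric_inequality _ \<alpha> \<longleftrightarrow>
     (\<exists>c>0. \<forall>E :: (real^'n) set.
        E \<in> sets lebesgue \<longrightarrow> bounded E \<longrightarrow> hermite_perimeter \<alpha> E < \<infinity> \<longrightarrow>
        ereal (measure lebesgue E powr (1 - 1 / real CARD('n))) \<le> ereal c * hermite_perimeter \<alpha> E)"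

end

theory Submission
  imports Defs
begin

text \<open>The potential terms of \<open>A_plus\<close> and \<open>A_minus\<close> have opposite signs. A field whose
  components number \<open>Inl i\<close> and \<open>Inr i\<close> are both \<open>\<eta> / 2\<close>, all others being zero, therefore has
  Hermite divergence \<open>\<partial>\<^sub>i \<eta>\<close>, and it is a test field as soon as \<open>\<eta>\<close> is a compactly supported
  \<open>C\<^sup>1\<close> function with \<open>\<bar>\<eta>\<bar> \<le> 1\<close>. So the Hermite variation \<open>V\<close> of \<open>f\<close> dominates
  \<open>\<integral> f \<partial>\<^sub>i \<eta>\<close> for all such \<open>\<eta>\<close> (\<open>hermite_variation_ge_partial\<close>), that is, every directional
  variation of \<open>f\<close> along a coordinate axis. It remains to prove the Euclidean Sobolev inequality
  for functions of bounded variation, which is done with the constant \<open>d\<close>.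

  For that, \<open>f\<close> is mollified. The function \<open>u = f * \<rho>\<close> is \<open>C\<^sup>1\<close>, tends to zero at infinity, and
  satisfies \<open>\<integral> \<bar>\<partial>\<^sub>i u\<bar> \<le> V\<close>: by Fubini, the integral of \<open>\<partial>\<^sub>i u\<close> against a bounded
  function \<open>s\<close> is the integral of \<open>f\<close> against the derivative of a mollification of \<open>s\<close>, and
  \<open>s\<close> may be the sign of \<open>\<partial>\<^sub>i u\<close>, cut off at a large radius
  (\<open>nn_integral_partial_conv_le\<close>). Integrating along
  a line parallel to the \<open>k\<close>-th axis gives \<open>\<bar>u x\<bar> \<le> \<integral> F\<close> over that line, where
  \<open>F = \<Sum>\<^sub>i \<bar>\<partial>\<^sub>i u\<bar>\<close>. Multiplying the \<open>(d - 1)\<close>-th roots of these \<open>d\<close> estimates, the bound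
  on the norm of \<open>u\<close> is reduced to \<open>gagliardo_inequality\<close>, an estimate for a
  single nonnegative function \<open>F\<close> which follows from Hoelder's inequality, one coordinate
  at a time. As the radius of the mollifier shrinks, \<open>u\<close> tends to \<open>f\<close> in the mean
  (\<open>moll_conv_tendsto\<close>), so almost everywhere along a subsequence, and Fatou's lemma transfers
  the bound to \<open>f\<close>.

  The isoperimetric inequality is Sobolev's inequality for the indicator function of the set.
  Both inequalities hold, hence they are equivalent.\<close>

section \<open>Hoelder's inequality for products of roots\<close>

text \<open>The exponent \<open>1 / (d - 1)\<close> enters the product estimates through the \<open>(d - 1)\<close>-th root alone,
  so that all their other powers have natural exponents, which are well behaved on the extended
  nonnegative reals.\<close>

definition eroot :: "nat \<Rightarrow> ennreal \<Rightarrow> ennreal" where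
  "eroot m a = (if a = top then top else ennreal (root m (enn2real a)))"

lemma eroot_0 [simp]: "eroot m 0 = 0"
  by (simp add: eroot_def)

lemma eroot_top [simp]: "eroot m top = top"
  by (simp add: eroot_def)

lemma eroot_ennreal [simp]: "0 \<le> a \<Longrightarrow> eroot m (ennreal a) = ennreal (root m a)"
  by (simp add: eroot_def)

lemma eroot_eq_0_iff: "0 < m \<Longrightarrow> eroot m a = 0 \<longleftrightarrow> a = 0"
  by (cases a) (auto simp: real_root_ge_zero ennreal_eq_0_iff)

lemma eroot_mono: assumes "0 < m" "a \<le> b" shows "eroot m a \<le> eroot m b"
  using assms by (cases a; cases b) (auto simp: ennreal_leI top_unique)

lemma measurable_eroot [measurable]: "eroot m \<in> borel_measurable borel"
  unfolding eroot_def[abs_def] by measurable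

text \<open>The inequality of the arithmetic and geometric means. After division by the mean \<open>s\<close> it
  is the product of the inequalities \<open>a k / s \<le> exp (a k / s - 1)\<close>, because the exponents
  on the right sum to zero.\<close>

lemma prod_le_mean_power:
  fixes a :: "'k \<Rightarrow> real"
  assumes "finite K" "K \<noteq> {}" and a: "\<And>k. k \<in> K \<Longrightarrow> 0 \<le> a k"
  shows "(\<Prod>k\<in>K. a k) \<le> ((\<Sum>k\<in>K. a k) / card K) ^ card K"
proof -
  define s where "s = (\<Sum>k\<in>K. a k) / card K"
  have c: "card K > 0" using assms by (simp add: card_gt_0_iff)
  show ?thesis
  proof (cases "s > 0")
    case True
    have "(\<Prod>k\<in>K. a k / s) \<le> (\<Prod>k\<in>K. exp (a k / s - 1))"
      using a True by (intro prod_mono) (auto intro: order_trans[OF _ exp_ge_add_one_self])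
    also have "\<dots> = exp ((\<Sum>k\<in>K. a k) / s - card K)"
      using assms by (simp add: exp_sum[symmetric] sum_subtractf sum_divide_distrib)
    also have "(\<Sum>k\<in>K. a k) / s - card K = 0"
      using True c by (simp add: s_def field_simps)
    finally have "(\<Prod>k\<in>K. a k) / s ^ card K \<le> 1"
      by (simp add: prod_dividef)
    then show ?thesis using True by (simp add: s_def[symmetric] field_simps)
  next
    case False
    have "(\<Sum>k\<in>K. a k) \<ge> 0" using a by (intro sum_nonneg)
    with False c have "(\<Sum>k\<in>K. a k) = 0"
      by (auto simp: s_def zero_less_divide_iff)
    then have "\<forall>k\<in>K. a k = 0" using assms by (simp add: sum_nonneg_eq_0_iff)
    with assms show ?thesis by (auto simp: s_def)
  qed
qed

text \<open>The pointwise form of Hoelder's inequality: \<open>J k\<close> will be the integral of \<open>g k\<close>, so that the last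
  factor integrates to one.\<close>

lemma prod_eroot_le:
  assumes K: "finite K" "card K = m" "0 < m"
    and J: "\<And>k. k \<in> K \<Longrightarrow> 0 < J k \<and> J k < top"
  shows "(\<Prod>k\<in>K. eroot m (g k)) \<le> (\<Prod>k\<in>K. eroot m (J k)) * ((\<Sum>k\<in>K. g k / J k) / of_nat m)"
proof (cases "\<exists>k\<in>K. g k = top")
  case True
  then obtain k where k: "k \<in> K" "g k = top" by auto
  have "g k / J k = top" using k J[of k] by (auto simp: ennreal_top_divide)
  then have "(\<Sum>k\<in>K. g k / J k) = top" using k K by (auto simp: sum.remove[of K k])
  moreover have "(\<Prod>k\<in>K. eroot m (J k)) \<noteq> 0"
    using J K by (fastforce simp: prod_zero_iff eroot_eq_0_iff)
  ultimately have "(\<Prod>k\<in>K. eroot m (J k)) * ((\<Sum>k\<in>K. g k / J k) / of_nat m) = top"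
    using K by (simp only: ennreal_top_divide) (simp add: ennreal_mult_top)
  then show ?thesis by simp
next
  case False
  define G where "G k = enn2real (g k)" for k
  define R where "R k = enn2real (J k)" for k
  have G: "k \<in> K \<Longrightarrow> g k = ennreal (G k)" "G k \<ge> 0" for k
    using False by (auto simp: G_def less_top)
  have R: "k \<in> K \<Longrightarrow> J k = ennreal (R k)" "k \<in> K \<Longrightarrow> R k > 0" for k
    using J[of k] by (auto simp: R_def less_top enn2real_positive_iff)
  have *: "(\<Prod>k\<in>K. root m (G k / R k)) \<le> (\<Sum>k\<in>K. G k / R k) / m"
  proof -
    have "(\<Prod>k\<in>K. root m (G k / R k)) ^ m = (\<Prod>k\<in>K. G k / R k)"
      using K G R unfolding prod_power_distrib
      by (intro prod.cong refl real_root_pow_pos2) (auto simp: less_imp_le)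
    also have "\<dots> \<le> ((\<Sum>k\<in>K. G k / R k) / m) ^ m"
      using prod_le_mean_power[of K "\<lambda>k. G k / R k"] K G R by (cases "K = {}") (auto simp: less_imp_le)
    finally show ?thesis
      using K G R by (subst (asm) power_mono_iff) (auto intro!: prod_nonneg sum_nonneg divide_nonneg_nonneg simp: less_imp_le)
  qed
  have "(\<Prod>k\<in>K. eroot m (g k)) = ennreal (\<Prod>k\<in>K. root m (G k))"
    using G K by (subst prod_ennreal[symmetric]) (auto simp: real_root_ge_zero cong: prod.cong)
  also have "(\<Prod>k\<in>K. root m (G k)) = (\<Prod>k\<in>K. root m (R k)) * (\<Prod>k\<in>K. root m (G k / R k))"
    using R(2) K unfolding prod.distrib[symmetric]
    by (intro prod.cong) (auto simp: real_root_divide dest: less_imp_neq[OF R(2)])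
  also have "\<dots> \<le> (\<Prod>k\<in>K. root m (R k)) * ((\<Sum>k\<in>K. G k / R k) / m)"
    using R by (intro mult_left_mono * prod_nonneg) (auto simp: less_imp_le real_root_ge_zero)
  also have "ennreal \<dots> = (\<Prod>k\<in>K. eroot m (J k)) * ((\<Sum>k\<in>K. g k / J k) / of_nat m)"
  proof -
    have "(\<Sum>k\<in>K. g k / J k) / of_nat m = ennreal ((\<Sum>k\<in>K. G k / R k) / m)"
      using G R K by (simp add: divide_ennreal sum_nonneg less_imp_le ennreal_of_nat_eq_real_of_nat cong: sum.cong)
    moreover have "(\<Prod>k\<in>K. eroot m (J k)) = ennreal (\<Prod>k\<in>K. root m (R k))"
      using R K by (subst prod_ennreal[symmetric]) (auto simp: real_root_ge_zero less_imp_le cong: prod.cong)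
    ultimately show ?thesis
      using R G K by (subst ennreal_mult) (auto intro!: prod_nonneg sum_nonneg divide_nonneg_nonneg simp: less_imp_le)
  qed
  finally show ?thesis by (simp add: ennreal_leI)
qed

text \<open>Hoelder's inequality with \<open>m\<close> equal exponents \<open>1 / m\<close>. It follows by integrating
  \<open>prod_eroot_le\<close> unless one of the integrals on the right is zero or infinite.\<close>

lemma nn_integral_prod_eroot_le:
  assumes K: "finite K" "card K = m" "0 < m"
    and g [measurable]: "\<And>k. k \<in> K \<Longrightarrow> g k \<in> borel_measurable M"
  shows "(\<integral>\<^sup>+x. (\<Prod>k\<in>K. eroot m (g k x)) \<partial>M) \<le> (\<Prod>k\<in>K. eroot m (\<integral>\<^sup>+x. g k x \<partial>M))"
proof -
  define J where "J k = (\<integral>\<^sup>+x. g k x \<partial>M)" for k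
  consider (z) k where "k \<in> K" "J k = 0"
    | (t) "\<forall>k\<in>K. J k \<noteq> 0" "\<exists>k\<in>K. J k = top"
    | (f) "\<forall>k\<in>K. 0 < J k \<and> J k < top"
    by (metis less_top not_gr_zero)
  then show ?thesis
  proof cases
    case z
    then have "AE x in M. g k x = 0" by (simp add: J_def nn_integral_0_iff_AE)
    then have "AE x in M. (\<Prod>k\<in>K. eroot m (g k x)) = 0"
      by eventually_elim (use z K in \<open>auto intro!: prod_zero bexI[of _ k]\<close>)
    then have "(\<integral>\<^sup>+x. (\<Prod>k\<in>K. eroot m (g k x)) \<partial>M) = 0"
      by (subst nn_integral_0_iff_AE) (auto)
    then show ?thesis by simp
  next
    case t
    then have "(\<Prod>k\<in>K. eroot m (J k)) = top"
      using K by (auto simp: ennreal_prod_eq_top eroot_eq_0_iff intro!: bexI)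
    then show ?thesis by (simp add: J_def)
  next
    case f
    have "(\<integral>\<^sup>+x. (\<Prod>k\<in>K. eroot m (g k x)) \<partial>M) \<le>
       (\<integral>\<^sup>+x. (\<Prod>k\<in>K. eroot m (J k)) * ((\<Sum>k\<in>K. g k x / J k) / of_nat m) \<partial>M)"
      using K f by (intro nn_integral_mono prod_eroot_le) auto
    also have "\<dots> = (\<Prod>k\<in>K. eroot m (J k)) * ((\<Sum>k\<in>K. J k / J k) / of_nat m)"
      by (simp add: nn_integral_cmult nn_integral_divide nn_integral_sum J_def[symmetric])
    also have "(\<Sum>k\<in>K. J k / J k) = of_nat m"
      using f K by (subst sum.cong[OF refl, of _ _ "\<lambda>_. 1"]) (auto simp: ennreal_divide_self)
    also have "of_nat m / of_nat m = (1::ennreal)"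
      using K by (intro ennreal_divide_self) (auto simp: less_top[symmetric])
    finally show ?thesis by (simp add: J_def)
  qed
qed


section \<open>Gagliardo's inequality for integrals along coordinate lines\<close>

text \<open>The integral of \<open>F\<close> over the line through \<open>x\<close> parallel to the \<open>i\<close>-th axis, again as a function
  of \<open>x\<close>. Points are functions rather than vectors, since iterating this operator
  then amounts to integrating over a product measure with a varying finite index set.\<close>

definition line_integral :: "'n \<Rightarrow> (('n \<Rightarrow> real) \<Rightarrow> ennreal) \<Rightarrow> ('n \<Rightarrow> real) \<Rightarrow> ennreal" where
  "line_integral i F x = (\<integral>\<^sup>+t. F (x(i := t)) \<partial>lborel)"

abbreviation coord_space :: "('n \<Rightarrow> real) measure" where
  "coord_space \<equiv> Pi\<^sub>M UNIV (\<lambda>_. lborel)"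

lemma measurable_update_coord [measurable]:
  "(\<lambda>(x, t). x(i := t)) \<in> coord_space \<Otimes>\<^sub>M lborel \<rightarrow>\<^sub>M coord_space"
  unfolding split_beta' by (rule measurable_fun_upd[where J=UNIV]) auto

lemma measurable_update_coord_line [measurable]:
  "(\<lambda>t. x(i := t)) \<in> lborel \<rightarrow>\<^sub>M coord_space"
  by (rule measurable_fun_upd[where J=UNIV]) (auto simp: space_PiM)

lemma measurable_line_integral [measurable]:
  assumes [measurable]: "F \<in> borel_measurable coord_space"
  shows "line_integral i F \<in> borel_measurable coord_space"
  unfolding line_integral_def[abs_def]
  by (rule lborel.borel_measurable_nn_integral)
     (use measurable_compose[OF measurable_update_coord assms] in \<open>simp add: split_beta'\<close>)

lemma line_integral_update [simp]: "line_integral i F (x(i := t)) = line_integral i F x"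
  by (simp add: line_integral_def)

lemma line_integral_mono: "(\<And>x. F x \<le> G x) \<Longrightarrow> line_integral i F x \<le> line_integral i G x"
  unfolding line_integral_def by (rule nn_integral_mono)

lemma fold_line_integral_mono:
  "(\<And>x. F x \<le> G x) \<Longrightarrow> fold line_integral xs F x \<le> fold line_integral xs G x"
proof (induction xs arbitrary: F G)
  case (Cons i xs)
  show ?case using Cons.IH[of "line_integral i F" "line_integral i G"] Cons.prems by (simp add: line_integral_mono)
qed simp

lemma line_integral_commute:
  assumes [measurable]: "F \<in> borel_measurable coord_space"
  shows "line_integral i (line_integral k F) = line_integral k (line_integral i F)"
proof (cases "i = k")
  case False
  have "(\<lambda>(t, s). x(i := t, k := s)) \<in> lborel \<Otimes>\<^sub>M lborel \<rightarrow>\<^sub>M coord_space" for x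
    unfolding split_beta' by (intro measurable_fun_upd[where J=UNIV]) (auto simp: space_PiM)
  \<comment> \<open>For distinct coordinates the claim is Tonelli's theorem in the plane.\<close>
  then have "(\<lambda>(t, s). F (x(i := t, k := s))) \<in> borel_measurable (lborel \<Otimes>\<^sub>M lborel)" for x
    unfolding split_beta' by (rule measurable_compose) (rule assms)
  from lborel_pair.Fubini'[OF this] show ?thesis
    using False by (auto simp: line_integral_def fun_eq_iff fun_upd_twist)
qed simp

lemma fold_line_integral_eq:
  fixes F :: "('n::finite \<Rightarrow> real) \<Rightarrow> ennreal"
  assumes "distinct xs" and "F \<in> borel_measurable coord_space"
  shows "fold line_integral xs F x =
    (\<integral>\<^sup>+z. F (\<lambda>k. if k \<in> set xs then z k else x k) \<partial>Pi\<^sub>M (set xs) (\<lambda>_. lborel))"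
  using assms
proof (induction xs arbitrary: F)
  case Nil
  interpret product_sigma_finite "\<lambda>_::'n. lborel :: real measure" ..
  show ?case by (simp add: PiM_empty nn_integral_count_space_finite)
next
  case (Cons i xs)
  interpret product_sigma_finite "\<lambda>_::'n. lborel :: real measure" ..
  note [measurable] = Cons.prems(2)
  have m: "(\<lambda>z k. if k \<in> set (i # xs) then z k else x k) \<in> Pi\<^sub>M (insert i (set xs)) (\<lambda>_. lborel) \<rightarrow>\<^sub>M coord_space"
  proof (rule measurable_PiM_single')
    show "(\<lambda>z. if k \<in> set (i # xs) then z k else x k) \<in> Pi\<^sub>M (insert i (set xs)) (\<lambda>_. lborel) \<rightarrow>\<^sub>M lborel" for k
      by (cases "k \<in> set (i # xs)") auto
  qed (auto simp: space_PiM)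
  have "fold line_integral (i # xs) F x =
      (\<integral>\<^sup>+z. line_integral i F (\<lambda>k. if k \<in> set xs then z k else x k) \<partial>Pi\<^sub>M (set xs) (\<lambda>_. lborel))"
    using Cons by simp
  also have "\<dots> = (\<integral>\<^sup>+z. \<integral>\<^sup>+t. F (\<lambda>k. if k \<in> set (i # xs) then (z(i := t)) k else x k) \<partial>lborel \<partial>Pi\<^sub>M (set xs) (\<lambda>_. lborel))"
    unfolding line_integral_def
    by (intro nn_integral_cong arg_cong[where f=F]) (auto simp: fun_eq_iff)
  also have "\<dots> = (\<integral>\<^sup>+z. F (\<lambda>k. if k \<in> set (i # xs) then z k else x k) \<partial>Pi\<^sub>M (insert i (set xs)) (\<lambda>_. lborel))"
    using Cons.prems by (intro product_nn_integral_insert[symmetric] measurable_compose[OF m]) auto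
  finally show ?case by simp
qed

text \<open>This is the inequality on grid lines from which Gagliardo's inequality is proved by induction:
  for the empty list both sides coincide, and for a list of all coordinates the inequality is the
  desired one. When the coordinate \<open>i\<close> is added, the factor for \<open>i\<close> does not depend on
  the \<open>i\<close>-th coordinate and leaves the inner integral; the other \<open>CARD('n) - 1 = m\<close> factors are
  estimated by Hoelder's inequality, which replaces \<open>F\<close> by \<open>line_integral i F\<close>
  in each of them. The claim for the shorter list then applies to \<open>line_integral i F\<close>.\<close>

lemma fold_line_integral_prod_le:
  fixes F :: "('n::finite \<Rightarrow> real) \<Rightarrow> ennreal"
  assumes m: "m = CARD('n) - 1" "0 < m"
    and "distinct xs" and "F \<in> borel_measurable coord_space"
  shows "fold line_integral xs (\<lambda>x. \<Prod>k\<in>UNIV. eroot m (if k \<in> set xs then line_integral k F x else F x)) x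
     \<le> eroot m (fold line_integral xs F x) ^ CARD('n)"
  using assms(3,4)
proof (induction xs arbitrary: F)
  case Nil
  then show ?case by simp
next
  case (Cons i xs)
  note [measurable] = Cons.prems(2)
  let ?L = line_integral
  have *: "?L i (\<lambda>x. \<Prod>k\<in>UNIV. eroot m (if k \<in> set (i # xs) then ?L k F x else F x)) x
      \<le> (\<Prod>k\<in>UNIV. eroot m (if k \<in> set xs then ?L k (?L i F) x else ?L i F x))" for x
  proof -
    have U: "UNIV = insert i (UNIV - {i})" by auto
    have "?L i (\<lambda>x. \<Prod>k\<in>UNIV. eroot m (if k \<in> set (i # xs) then ?L k F x else F x)) x
       = (\<integral>\<^sup>+t. eroot m (?L i F x) * (\<Prod>k\<in>UNIV - {i}. eroot m (if k \<in> set xs then ?L k F (x(i := t)) else F (x(i := t)))) \<partial>lborel)"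
      unfolding line_integral_def[of i "\<lambda>x. \<Prod>k\<in>UNIV. _ k x"]
      by (subst U, subst prod.insert) (auto intro!: nn_integral_cong arg_cong2[where f="(*)"] prod.cong)
    also have "\<dots> = eroot m (?L i F x) * (\<integral>\<^sup>+t. (\<Prod>k\<in>UNIV - {i}. eroot m (if k \<in> set xs then ?L k F (x(i := t)) else F (x(i := t)))) \<partial>lborel)"
      by (rule nn_integral_cmult) measurable
    also have "\<dots> \<le> eroot m (?L i F x) * (\<Prod>k\<in>UNIV - {i}. eroot m (\<integral>\<^sup>+t. (if k \<in> set xs then ?L k F (x(i := t)) else F (x(i := t))) \<partial>lborel))"
      using m by (intro mult_left_mono nn_integral_prod_eroot_le) (auto simp: card_Diff_singleton)
    also have "\<dots> = eroot m (?L i F x) * (\<Prod>k\<in>UNIV - {i}. eroot m (if k \<in> set xs then ?L k (?L i F) x else ?L i F x))"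
      by (intro arg_cong2[where f="(*)"] prod.cong refl)
         (auto simp: line_integral_commute[of F _ i] line_integral_def[of i] cong: if_cong)
    also have "\<dots> = (\<Prod>k\<in>UNIV. eroot m (if k \<in> set xs then ?L k (?L i F) x else ?L i F x))"
      using Cons.prems by (subst (2) U, subst prod.insert) auto
    finally show ?thesis .
  qed
  have "fold ?L (i # xs) (\<lambda>x. \<Prod>k\<in>UNIV. eroot m (if k \<in> set (i # xs) then ?L k F x else F x)) x
    \<le> fold ?L xs (\<lambda>x. \<Prod>k\<in>UNIV. eroot m (if k \<in> set xs then ?L k (?L i F) x else ?L i F x)) x"
    using fold_line_integral_mono[OF *] by simp
  also have "\<dots> \<le> eroot m (fold ?L xs (?L i F) x) ^ CARD('n)"
    using Cons by (intro Cons.IH) auto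
  finally show ?case by simp
qed

lemma nn_integral_prod_line_integral_le:
  fixes F :: "('n::finite \<Rightarrow> real) \<Rightarrow> ennreal"
  assumes m: "m = CARD('n) - 1" "0 < m" and [measurable]: "F \<in> borel_measurable coord_space"
  shows "(\<integral>\<^sup>+x. (\<Prod>k\<in>UNIV. eroot m (line_integral k F x)) \<partial>coord_space)
     \<le> eroot m (\<integral>\<^sup>+x. F x \<partial>coord_space) ^ CARD('n)"
proof -
  obtain xs :: "'n list" where xs: "set xs = UNIV" "distinct xs"
    using finite_distinct_list[of "UNIV :: 'n set"] by auto
  have *: "fold line_integral xs G x = (\<integral>\<^sup>+x. G x \<partial>coord_space)"
    if [measurable]: "G \<in> borel_measurable coord_space" for G :: "('n \<Rightarrow> real) \<Rightarrow> ennreal" and x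
    using fold_line_integral_eq[OF xs(2) that] xs(1) by simp
  show ?thesis
    using fold_line_integral_prod_le[OF m xs(2), of F undefined] xs(1) by (simp add: *)
qed

lemma measurable_vec_lambda [measurable]:
  "(vec_lambda :: ('n::finite \<Rightarrow> real) \<Rightarrow> _) \<in> borel_measurable coord_space"
  by (subst borel_measurable_euclidean_space) (auto simp: Basis_vec_def inner_axis)

text \<open>This carries estimates between functions on vectors and functions on the product space.\<close>

lemma lborel_vec_eq_distr:
  "(lborel :: (real^'n::finite) measure) = distr coord_space borel vec_lambda"
proof (rule lborel_eqI)
  interpret product_sigma_finite "\<lambda>_::'n. lborel :: real measure" ..
  fix l u :: "real^'n" assume lu: "\<And>b. b \<in> Basis \<Longrightarrow> l \<bullet> b \<le> u \<bullet> b"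
  then have lu': "l $ k \<le> u $ k" for k
    using lu[of "axis k 1"] by (auto simp: inner_axis)
  have "vec_lambda -` box l u \<inter> space coord_space = (\<Pi>\<^sub>E k\<in>UNIV. {l $ k <..< u $ k})"
    by (auto simp: space_PiM mem_box_cart PiE_iff)
  then have "emeasure (distr coord_space borel vec_lambda) (box l u) = (\<Prod>k\<in>UNIV. ennreal (u $ k - l $ k))"
    using lu' by (simp add: emeasure_distr emeasure_PiM)
  also have "\<dots> = ennreal (\<Prod>k\<in>UNIV. (u - l) $ k)"
    using lu' by (simp add: prod_ennreal)
  also have "(\<Prod>k\<in>UNIV. (u - l) $ k) = (\<Prod>b\<in>Basis. (u - l) \<bullet> b)"
  proof -
    have "Basis = range (\<lambda>k. axis k 1 :: real^'n)"
      by (auto simp: Basis_vec_def)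
    moreover have inj: "inj (\<lambda>k. axis k 1 :: real^'n)"
      by (auto simp: inj_on_def axis_eq_axis)
    ultimately show ?thesis
      using prod.reindex[OF inj, of "\<lambda>b. (u - l) \<bullet> b"] by (simp only: cart_eq_inner_axis o_def)
  qed
  finally show "emeasure (distr coord_space borel vec_lambda) (box l u) = ennreal (\<Prod>b\<in>Basis. (u - l) \<bullet> b)" .
qed simp

lemma measurable_vec_nth [measurable]: "(\<lambda>x. x $ k) \<in> borel_measurable (borel :: (real^'n) measure)"
  by (intro borel_measurable_continuous_onI continuous_intros)

text \<open>Inside the root on the left, \<open>F\<close> is integrated over the line through \<open>x\<close> parallel to the
  \<open>k\<close>-th axis; the parameter \<open>t\<close> is the \<open>k\<close>-th coordinate of the moving point.\<close>

lemma gagliardo_inequality: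
  fixes F :: "real^'n::finite \<Rightarrow> ennreal"
  assumes m: "m = CARD('n) - 1" "0 < m" and [measurable]: "F \<in> borel_measurable borel"
  shows "(\<integral>\<^sup>+x. (\<Prod>k\<in>UNIV. eroot m (\<integral>\<^sup>+t. F (x + (t - x $ k) *\<^sub>R axis k 1) \<partial>lborel)) \<partial>lborel)
     \<le> eroot m (\<integral>\<^sup>+x. F x \<partial>lborel) ^ CARD('n)"
proof -
  have eq: "vec_lambda (x(k := t)) = vec_lambda x + (t - vec_lambda x $ k) *\<^sub>R axis k 1"
    for x :: "'n \<Rightarrow> real" and t k
    by (auto simp: vec_eq_iff axis_def)
  show ?thesis
    using nn_integral_prod_line_integral_le[OF m, of "\<lambda>x. F (vec_lambda x)"]
    unfolding lborel_vec_eq_distr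
    by (simp add: nn_integral_distr line_integral_def eq)
qed

section \<open>Convolution and mollifiers\<close>

text \<open>The kernel may be vector valued, so that the same notion covers a mollified function and its gradient.\<close>

definition conv :: "('a::euclidean_space \<Rightarrow> real) \<Rightarrow> ('a \<Rightarrow> 'b::euclidean_space) \<Rightarrow> 'a \<Rightarrow> 'b" where
  "conv g k x = (\<integral>y. g y *\<^sub>R k (x - y) \<partial>lborel)"

lemma measurable_continuous_reflect:
  fixes k :: "'a::euclidean_space \<Rightarrow> 'b::euclidean_space"
  assumes "continuous_on UNIV k" shows "(\<lambda>y. k (x - y)) \<in> borel_measurable borel"
  by (intro borel_measurable_continuous_onI continuous_on_compose2[OF assms] continuous_intros) auto

lemma integrable_conv_integrand:
  fixes k :: "'a::euclidean_space \<Rightarrow> 'b::euclidean_space"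
  assumes g: "integrable lborel g" and k: "continuous_on UNIV k" "\<And>z. norm (k z) \<le> K"
  shows "integrable lborel (\<lambda>y. g y *\<^sub>R k (x - y))"
proof (rule Bochner_Integration.integrable_bound)
  show "integrable lborel (\<lambda>y. K * \<bar>g y\<bar>)" using g by auto
  show "(\<lambda>y. g y *\<^sub>R k (x - y)) \<in> borel_measurable lborel"
    using measurable_continuous_reflect[OF k(1), of x] g by auto
  have "\<bar>g y\<bar> * norm (k (x - y)) \<le> \<bar>K * \<bar>g y\<bar>\<bar>" for y
  proof -
    have "\<bar>g y\<bar> * norm (k (x - y)) \<le> \<bar>g y\<bar> * K" by (intro mult_left_mono k) auto
    then show ?thesis by (simp add: mult.commute)
  qed
  then show "AE y in lborel. norm (g y *\<^sub>R k (x - y)) \<le> norm (K * \<bar>g y\<bar>)" by simp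
qed

lemma tendsto_conv_sequence:
  fixes k :: "'a::euclidean_space \<Rightarrow> 'b::euclidean_space"
  assumes g: "integrable lborel g" and k: "continuous_on UNIV k" "\<And>z. norm (k z) \<le> K"
    and X: "\<And>y. (\<lambda>n. k (X n - y)) \<longlonglongrightarrow> l y" and l: "l \<in> borel_measurable borel"
  shows "(\<lambda>n. conv g k (X n)) \<longlonglongrightarrow> (\<integral>y. g y *\<^sub>R l y \<partial>lborel)"
  unfolding conv_def
proof (rule integral_dominated_convergence)
  show "integrable lborel (\<lambda>y. K * \<bar>g y\<bar>)" using g by auto
  show "(\<lambda>y. g y *\<^sub>R l y) \<in> borel_measurable lborel" using g l by auto
  show "(\<lambda>y. g y *\<^sub>R k (X n - y)) \<in> borel_measurable lborel" for n
    using measurable_continuous_reflect[OF k(1)] g by auto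
  show "AE y in lborel. (\<lambda>n. g y *\<^sub>R k (X n - y)) \<longlonglongrightarrow> g y *\<^sub>R l y"
    using X by (auto intro!: tendsto_intros)
  have "\<bar>g y\<bar> * norm (k z) \<le> K * \<bar>g y\<bar>" for y z
    using mult_left_mono[OF k(2), of "\<bar>g y\<bar>" z] by (simp add: mult.commute)
  then show "AE y in lborel. norm (g y *\<^sub>R k (X n - y)) \<le> K * \<bar>g y\<bar>" for n by simp
qed

lemma continuous_conv:
  fixes k :: "'a::euclidean_space \<Rightarrow> 'b::euclidean_space"
  assumes g: "integrable lborel g" and k: "continuous_on UNIV k" "\<And>z. norm (k z) \<le> K"
  shows "continuous_on UNIV (conv g k)"
proof -
  have "(\<lambda>n. conv g k (X n)) \<longlonglongrightarrow> conv g k x" if "X \<longlonglongrightarrow> x" for X x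
    unfolding conv_def[of g k x]
  proof (rule tendsto_conv_sequence[OF g k])
    show "(\<lambda>n. k (X n - y)) \<longlonglongrightarrow> k (x - y)" for y
      by (rule continuous_on_tendsto_compose[OF k(1)]) (auto intro!: tendsto_intros that)
  qed (rule measurable_continuous_reflect[OF k(1)])
  then show ?thesis
    by (auto simp: continuous_on_sequentially o_def)
qed

lemma conv_tendsto_0_at_infinity:
  fixes k :: "'a::euclidean_space \<Rightarrow> 'b::euclidean_space"
  assumes g: "integrable lborel g" and k: "continuous_on UNIV k" "\<And>z. norm (k z) \<le> K"
    and supp: "\<And>z. norm z > r \<Longrightarrow> k z = 0"
    and X: "filterlim X at_infinity sequentially"
  shows "(\<lambda>n. conv g k (X n)) \<longlonglongrightarrow> 0"
proof -
  have "(\<lambda>n. k (X n - y)) \<longlonglongrightarrow> 0" for y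
  proof (rule tendsto_eventually)
    have "eventually (\<lambda>n. r + norm y + 1 \<le> norm (X n)) sequentially"
    proof (cases "r + norm y + 1 > 0")
      case True
      then show ?thesis using X[unfolded filterlim_at_infinity[OF order_refl]] by blast
    next
      case False
      then have "r + norm y + 1 \<le> norm (X n)" for n
        using norm_ge_zero[of "X n"] by linarith
      then show ?thesis by simp
    qed
    then show "eventually (\<lambda>n. k (X n - y) = 0) sequentially"
    proof eventually_elim
      case (elim n)
      then have "norm (X n - y) > r" using norm_triangle_ineq2[of "X n" y] by linarith
      then show ?case by (rule supp)
    qed
  qed
  from tendsto_conv_sequence[OF g k this] show ?thesis by simp
qed

text \<open>Differentiation under the integral sign. The error quotients \<open>q\<close> of the kernel tend to zero
  pointwise, and by the mean value theorem they are bounded by twice the bound for the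
  gradient, so dominated convergence applies.\<close>

lemma conv_has_derivative:
  fixes k :: "'a::euclidean_space \<Rightarrow> real" and G :: "'a \<Rightarrow> 'a"
  assumes g: "integrable lborel g" and k: "\<And>z. \<bar>k z\<bar> \<le> K'"
    and G: "continuous_on UNIV G" "\<And>z. norm (G z) \<le> K"
    and D: "\<And>z. (k has_derivative (\<lambda>h. G z \<bullet> h)) (at z)"
  shows "(conv g k has_derivative (\<lambda>h. conv g G x \<bullet> h)) (at x)"
  unfolding has_derivative_at
proof (intro conjI bounded_linear_inner_right, subst tendsto_at_iff_sequentially, intro allI impI)
  have ck: "continuous_on UNIV k"
    using D by (auto simp: continuous_on_eq_continuous_at intro: has_derivative_continuous)
  define q where "q z h = \<bar>k (z + h) - k z - G z \<bullet> h\<bar> / norm h" for z h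
  have mv: "\<bar>k (z + h) - k z\<bar> \<le> K * norm h" for z h
  proof -
    have "norm (k (z + h) - k z) \<le> K * norm (z + h - z)"
    proof (rule differentiable_bound[OF convex_UNIV, of k "\<lambda>z h. G z \<bullet> h"])
      show "onorm ((\<bullet>) (G x)) \<le> K" for x
      proof (rule onorm_bound)
        show "0 \<le> K" using order_trans[OF norm_ge_zero G(2)] .
        show "norm (G x \<bullet> h) \<le> K * norm h" for h
          using Cauchy_Schwarz_ineq2[of "G x" h] mult_right_mono[OF G(2)[of x], of "norm h"] by simp
      qed
    qed (use D in \<open>auto intro: has_derivative_at_withinI\<close>)
    then show ?thesis by simp
  qed
  have q: "0 \<le> q z h" "q z h \<le> 2 * K" if "h \<noteq> 0" for z h
  proof -
    have "\<bar>k (z + h) - k z - G z \<bullet> h\<bar> \<le> K * norm h + K * norm h"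
      using mv[of z h] Cauchy_Schwarz_ineq2[of "G z" h] mult_right_mono[OF G(2)[of z] norm_ge_zero[of h]]
      by linarith
    then show "q z h \<le> 2 * K" using that by (simp add: q_def field_simps)
  qed (simp add: q_def)
  fix X :: "nat \<Rightarrow> 'a" assume X0: "\<forall>n. X n \<in> UNIV - {0}" and X: "X \<longlonglongrightarrow> 0"
  have mq: "(\<lambda>y. q (x - y) h) \<in> borel_measurable borel" for h
    unfolding q_def
    using measurable_continuous_reflect[OF ck, of "x + h"] measurable_continuous_reflect[OF ck, of x] measurable_continuous_reflect[OF G(1), of x]
    by (simp add: algebra_simps)
  have bound: "\<bar>g y\<bar> * q (x - y) (X n) \<le> 2 * K * \<bar>g y\<bar>" for y n
    using mult_left_mono[OF q(2)[of "X n" "x - y"], of "\<bar>g y\<bar>"] X0 by (simp add: mult.commute)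
  have lim: "(\<lambda>n. \<integral>y. \<bar>g y\<bar> * q (x - y) (X n) \<partial>lborel) \<longlonglongrightarrow> (\<integral>y. 0 \<partial>(lborel :: 'a measure))"
  proof (rule integral_dominated_convergence)
    show "integrable lborel (\<lambda>y. 2 * K * \<bar>g y\<bar>)" using g by auto
    show "(\<lambda>y. \<bar>g y\<bar> * q (x - y) (X n)) \<in> borel_measurable lborel" for n
      using g mq by auto
    show "AE y in lborel. (\<lambda>n. \<bar>g y\<bar> * q (x - y) (X n)) \<longlonglongrightarrow> 0"
    proof (intro AE_I2 tendsto_mult_right_zero)
      fix y
      have "((\<lambda>h. q (x - y) h) \<longlongrightarrow> 0) (at 0)"
        using D[of "x - y"] unfolding has_derivative_at q_def by simp
      then show "(\<lambda>n. q (x - y) (X n)) \<longlonglongrightarrow> 0"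
        using X0 X by (auto simp: tendsto_at_iff_sequentially o_def)
    qed
    show "AE y in lborel. norm (\<bar>g y\<bar> * q (x - y) (X n)) \<le> 2 * K * \<bar>g y\<bar>" for n
      using bound q(1) X0 by (auto simp: abs_mult)
  qed simp
  have K0: "0 \<le> K" using order_trans[OF norm_ge_zero G(2)] .
  have est: "norm (conv g k (x + X n) - conv g k x - conv g G x \<bullet> X n) / norm (X n)
      \<le> (\<integral>y. \<bar>g y\<bar> * q (x - y) (X n) \<partial>lborel)" for n
  proof -
    have i1: "integrable lborel (\<lambda>y. g y *\<^sub>R k (x - y))" for x
      using integrable_conv_integrand[OF g ck, of K'] k by auto
    have i2: "integrable lborel (\<lambda>y. g y *\<^sub>R G (x - y))" for x
      using integrable_conv_integrand[OF g G] by auto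
    define F where "F y = g y * (k (x - y + X n) - k (x - y) - G (x - y) \<bullet> X n)" for y
    have hpos: "norm (X n) > 0" using X0 by simp
    have "F = (\<lambda>y. (g y *\<^sub>R k (x + X n - y) - g y *\<^sub>R k (x - y)) - (g y *\<^sub>R G (x - y)) \<bullet> X n)"
      by (simp add: fun_eq_iff F_def algebra_simps)
    then have "integral\<^sup>L lborel F = integral\<^sup>L lborel (\<lambda>y. (g y *\<^sub>R k (x + X n - y) - g y *\<^sub>R k (x - y)) - (g y *\<^sub>R G (x - y)) \<bullet> X n)"
      by (rule arg_cong)
    also have "\<dots> = conv g k (x + X n) - conv g k x - (\<integral>y. (g y *\<^sub>R G (x - y)) \<bullet> X n \<partial>lborel)"
      unfolding conv_def
      by (simp only: Bochner_Integration.integral_diff[OF Bochner_Integration.integrable_diff[OF i1 i1] integrable_inner_left[OF i2]]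
          Bochner_Integration.integral_diff[OF i1 i1])
    also have "(\<integral>y. (g y *\<^sub>R G (x - y)) \<bullet> X n \<partial>lborel) = conv g G x \<bullet> X n"
      unfolding conv_def by (rule integral_inner_left) (rule i2)
    finally have "norm (conv g k (x + X n) - conv g k x - conv g G x \<bullet> X n) = norm (integral\<^sup>L lborel F)"
      by simp
    also have "\<dots> \<le> (\<integral>y. norm (F y) \<partial>lborel)"
      by (rule integral_norm_bound)
    also have "(\<lambda>y. norm (F y)) = (\<lambda>y. norm (X n) * (\<bar>g y\<bar> * q (x - y) (X n)))"
      using hpos by (simp add: F_def q_def abs_mult)
    finally show ?thesis
      using hpos by (simp add: pos_divide_le_eq mult.commute)
  qed
  show "((\<lambda>h. norm (conv g k (x + h) - conv g k x - conv g G x \<bullet> h) / norm h) \<circ> X) \<longlonglongrightarrow> 0"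
    unfolding o_def
    by (rule tendsto_sandwich[OF _ _ tendsto_const lim[simplified]]) (use est in simp_all)
qed

lemma conv_support:
  assumes "\<And>y. norm y > R \<Longrightarrow> g y = 0" "\<And>z. norm z > r \<Longrightarrow> k z = 0" "norm x > R + r"
  shows "conv g k x = 0"
proof -
  have "g y *\<^sub>R k (x - y) = 0" for y
    using assms norm_triangle_ineq2[of x y] by (cases "norm y > R") auto
  then show ?thesis unfolding conv_def by (simp only: integral_zero)
qed

lemma lborel_integral_reflect:
  fixes k :: "'a::euclidean_space \<Rightarrow> real"
  assumes k [measurable]: "k \<in> borel_measurable borel"
  shows "(\<integral>y. k (x - y) \<partial>lborel) = (\<integral>y. k y \<partial>lborel)"
    and "integrable lborel k \<Longrightarrow> integrable lborel (\<lambda>y. k (x - y))"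
    and "(\<integral>\<^sup>+y. k (x - y) \<partial>lborel) = (\<integral>\<^sup>+y. k y \<partial>lborel)"
proof -
  have "(lborel :: 'a measure) = density (distr lborel borel (\<lambda>y. x + (-1) *\<^sub>R y)) (\<lambda>_. \<bar>- 1 :: real\<bar> ^ DIM('a))"
    by (rule lborel_affine) simp
  then have *: "(lborel :: 'a measure) = distr lborel borel (\<lambda>y. x - y)"
    by (simp add: density_1)
  show "integrable lborel k \<Longrightarrow> integrable lborel (\<lambda>y. k (x - y))"
    by (subst (asm) *) (rule integrable_distr[of "\<lambda>y. x - y" lborel borel k]; simp)
  show "(\<integral>\<^sup>+y. k (x - y) \<partial>lborel) = (\<integral>\<^sup>+y. k y \<partial>lborel)"
    by (subst (2) *) (simp add: nn_integral_distr)
  show "(\<integral>y. k (x - y) \<partial>lborel) = (\<integral>y. k y \<partial>lborel)"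
    by (subst (2) *) (simp add: integral_distr)
qed

text \<open>Evenness and odd gradient make convolution with \<open>\<rho>\<close> self-adjoint, and convolution with \<open>G\<close>
  skew-adjoint, for the pairing \<open>\<integral> f g\<close>.\<close>

locale mollifier =
  fixes \<rho> :: "'a::euclidean_space \<Rightarrow> real" and G :: "'a \<Rightarrow> 'a" and r :: real
  assumes nonneg: "0 \<le> \<rho> z"
    and even: "\<rho> (- z) = \<rho> z"
    and support: "norm z > r \<Longrightarrow> \<rho> z = 0"
    and deriv: "(\<rho> has_derivative (\<lambda>h. G z \<bullet> h)) (at z)"
    and grad_odd: "G (- z) = - G z"
    and grad_support: "norm z > r \<Longrightarrow> G z = 0"
    and grad_continuous: "continuous_on UNIV G"
    and integral_1: "integral\<^sup>L lborel \<rho> = 1"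
begin

lemma continuous: "continuous_on UNIV \<rho>"
  using deriv by (auto simp: continuous_on_eq_continuous_at intro: has_derivative_continuous)

lemma measurable [measurable]: "\<rho> \<in> borel_measurable borel"
  by (intro borel_measurable_continuous_onI continuous)

lemma integrable: "integrable lborel \<rho>"
  using integral_1 not_integrable_integral_eq[of lborel \<rho>] by fastforce

lemma compact_support_bounded:
  fixes k :: "'a \<Rightarrow> 'b::euclidean_space"
  assumes "continuous_on UNIV k" "\<And>z. norm z > s \<Longrightarrow> k z = 0"
  obtains K where "\<And>z. norm (k z) \<le> K"
proof -
  have "bounded (k ` cball 0 s)"
    by (intro compact_imp_bounded compact_continuous_image continuous_on_subset[OF assms(1)]) auto
  then obtain K where K: "\<And>z. norm z \<le> s \<Longrightarrow> norm (k z) \<le> K"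
    unfolding bounded_iff by fastforce
  have "norm (k z) \<le> max K 0" for z
    using K[of z] assms(2)[of z] by (cases "norm z \<le> s") auto
  then show ?thesis by (rule that)
qed

lemma bounded: "\<exists>K. \<forall>z. \<bar>\<rho> z\<bar> \<le> K"
  by (rule compact_support_bounded[OF continuous support]) auto

lemma grad_bounded: "\<exists>K. \<forall>z. norm (G z) \<le> K"
  by (rule compact_support_bounded[OF grad_continuous grad_support]) auto

lemma mollified_has_derivative:
  assumes "integrable lborel g"
  shows "(conv g \<rho> has_derivative (\<lambda>h. conv g G x \<bullet> h)) (at x)"
proof -
  from bounded grad_bounded obtain K K' where "\<And>z. \<bar>\<rho> z\<bar> \<le> K" "\<And>z. norm (G z) \<le> K'" by blast
  then show ?thesis
    by (intro conv_has_derivative[OF assms, of \<rho> K G K'] deriv grad_continuous)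
qed

lemma continuous_mollified_grad: "integrable lborel g \<Longrightarrow> continuous_on UNIV (conv g G)"
  using grad_bounded by (auto intro: continuous_conv grad_continuous)

lemma continuous_mollified: "integrable lborel g \<Longrightarrow> continuous_on UNIV (conv g \<rho>)"
  using bounded continuous_conv[OF _ continuous, of g] by auto

lemma abs_conv_le:
  assumes g: "\<And>y. \<bar>g y\<bar> \<le> M"
  shows "\<bar>conv g \<rho> x\<bar> \<le> M"
proof -
  have "\<bar>conv g \<rho> x\<bar> \<le> (\<integral>y. M * \<rho> (x - y) \<partial>lborel)"
    unfolding conv_def real_norm_def[symmetric]
    using g nonneg lborel_integral_reflect(2)[OF measurable integrable] order_trans[OF abs_ge_zero g]
    by (intro order_trans[OF integral_norm_bound] integral_mono_AE') (auto simp: abs_mult intro: mult_right_mono)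
  then show ?thesis using lborel_integral_reflect(1)[OF measurable, of x] integral_1 by simp
qed

lemma mollified_integrand_integrable:
  assumes "integrable lborel g" shows "integrable lborel (\<lambda>y. g y * \<rho> (x - y))"
  using bounded integrable_conv_integrand[OF assms continuous, of _ x] by auto

text \<open>Convolution with a kernel of mass one is a contraction of \<open>L\<^sup>1\<close>, by Tonelli's theorem.\<close>

lemma nn_integral_abs_conv_le:
  assumes g: "integrable lborel g"
  shows "(\<integral>\<^sup>+x. ennreal \<bar>conv g \<rho> x\<bar> \<partial>lborel) \<le> (\<integral>\<^sup>+x. ennreal \<bar>g x\<bar> \<partial>lborel)"
proof -
  have [measurable]: "g \<in> borel_measurable borel" using g by auto
  have "ennreal \<bar>conv g \<rho> x\<bar> \<le> (\<integral>\<^sup>+y. ennreal \<bar>g y\<bar> * ennreal (\<rho> (x - y)) \<partial>lborel)" for x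
  proof -
    have "ennreal \<bar>conv g \<rho> x\<bar> \<le> (\<integral>\<^sup>+y. ennreal (norm (g y * \<rho> (x - y))) \<partial>lborel)"
      using integral_norm_bound_ennreal[OF mollified_integrand_integrable[OF g, of x]] by (simp add: conv_def)
    then show ?thesis using nonneg by (simp add: abs_mult ennreal_mult)
  qed
  then have "(\<integral>\<^sup>+x. ennreal \<bar>conv g \<rho> x\<bar> \<partial>lborel) \<le> (\<integral>\<^sup>+x. \<integral>\<^sup>+y. ennreal \<bar>g y\<bar> * ennreal (\<rho> (x - y)) \<partial>lborel \<partial>lborel)"
    by (rule nn_integral_mono)
  also have "\<dots> = (\<integral>\<^sup>+y. \<integral>\<^sup>+x. ennreal \<bar>g y\<bar> * ennreal (\<rho> (x - y)) \<partial>lborel \<partial>lborel)"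
    by (rule lborel_pair.Fubini') simp
  also have "\<dots> = (\<integral>\<^sup>+y. ennreal \<bar>g y\<bar> * (\<integral>\<^sup>+x. ennreal (\<rho> (x - y)) \<partial>lborel) \<partial>lborel)"
    by (intro nn_integral_cong nn_integral_cmult) auto
  also have "\<dots> = (\<integral>\<^sup>+y. ennreal \<bar>g y\<bar> \<partial>lborel)"
  proof (intro nn_integral_cong)
    fix y
    have "(\<integral>\<^sup>+x. ennreal (\<rho> (x - y)) \<partial>lborel) = (\<integral>\<^sup>+x. ennreal (\<rho> (y - x)) \<partial>lborel)"
      by (metis even minus_diff_eq)
    also have "\<dots> = (\<integral>\<^sup>+x. ennreal (\<rho> x) \<partial>lborel)" by (rule lborel_integral_reflect) simp
    also have "\<dots> = 1" using nn_integral_eq_integral[OF integrable] nonneg integral_1 by simp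
    finally show "ennreal \<bar>g y\<bar> * (\<integral>\<^sup>+x. ennreal (\<rho> (x - y)) \<partial>lborel) = ennreal \<bar>g y\<bar>" by simp
  qed
  finally show ?thesis .
qed

end

lemma DERIV_max_0_power2: "((\<lambda>s. (max 0 s)\<^sup>2) has_real_derivative 2 * max 0 s) (at s)"
proof -
  consider "s > 0" | "s < 0" | "s = 0" by linarith
  then show ?thesis
  proof cases
    case 1
    have "((\<lambda>s. s\<^sup>2) has_real_derivative 2 * s) (at s)"
      by (auto intro!: derivative_eq_intros)
    then show ?thesis
      using 1 by (subst has_field_derivative_cong_eventually[where g="\<lambda>s. s\<^sup>2"])
        (auto intro!: eventually_mono[OF eventually_at_in_open[OF open_greaterThan, of s 0]])
  next
    case 2
    have "((\<lambda>s. 0) has_real_derivative 0) (at s)" by simp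
    then show ?thesis
      using 2 by (subst has_field_derivative_cong_eventually[where g="\<lambda>s. 0"])
        (auto intro!: eventually_mono[OF eventually_at_in_open[OF open_lessThan, of s 0]])
  next
    case 3
    have "((\<lambda>h::real. max 0 h) \<longlongrightarrow> max 0 0) (at 0)"
      by (intro tendsto_intros)
    then have "((\<lambda>h. ((max 0 (0 + h))\<^sup>2 - (max 0 0)\<^sup>2) / h) \<longlongrightarrow> max 0 (0::real)) (at 0)"
      by (rule Lim_transform_eventually)
         (auto simp: eventually_at_filter power2_eq_square max_def)
    then show ?thesis using 3 by (simp add: DERIV_def)
  qed
qed

text \<open>Up to a constant factor, this is the mollifier of radius \<open>r\<close>: squaring the truncated
  paraboloid is enough for a continuous gradient.\<close>

definition bump :: "real \<Rightarrow> 'a::euclidean_space \<Rightarrow> real" where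
  "bump r x = (max 0 (r\<^sup>2 - x \<bullet> x))\<^sup>2"

definition bump_grad :: "real \<Rightarrow> 'a::euclidean_space \<Rightarrow> 'a" where
  "bump_grad r x = - (4 * max 0 (r\<^sup>2 - x \<bullet> x)) *\<^sub>R x"

lemma mollifier_bump:
  fixes r :: real
  assumes r: "r > 0"
  defines "c \<equiv> integral\<^sup>L lborel (bump r :: 'a::euclidean_space \<Rightarrow> real)"
  shows "mollifier (\<lambda>x::'a. bump r x / c) (\<lambda>x. bump_grad r x /\<^sub>R c) r"
proof -
  let ?b = "bump r :: 'a \<Rightarrow> real"
  have supp: "r\<^sup>2 - z \<bullet> z < 0" if "norm z > r" for z :: 'a
    using r that power_strict_mono[of r "norm z" 2] by (simp add: power2_norm_eq_inner)
  have m0: "max 0 (r\<^sup>2 - z \<bullet> z) = 0" if "norm z > r" for z :: 'a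
    using supp[OF that] by simp
  have supp': "r\<^sup>2 - z \<bullet> z > 0" if "norm z < r" for z :: 'a
    using r that power_strict_mono[of "norm z" r 2] by (simp add: power2_norm_eq_inner)
  have D: "(?b has_derivative (\<lambda>h. bump_grad r z \<bullet> h)) (at z)" for z
  proof -
    have "((\<lambda>x. r\<^sup>2 - x \<bullet> x) has_derivative (\<lambda>h. - 2 * (z \<bullet> h))) (at z)"
      by (auto intro!: derivative_eq_intros simp: inner_commute)
    from has_derivative_compose[OF this DERIV_max_0_power2[unfolded has_field_derivative_def]]
    show ?thesis unfolding bump_def[abs_def] bump_grad_def by (simp add: mult_ac)
  qed
  have cont: "continuous_on UNIV ?b"
    unfolding bump_def by (intro continuous_intros)
  have int: "integrable lborel ?b"
  proof -
    have "integrable lborel (\<lambda>x. indicator (cball 0 r) x *\<^sub>R ?b x)"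
      by (intro borel_integrable_compact continuous_on_subset[OF cont]) auto
    moreover have "(\<lambda>x. indicator (cball 0 r) x *\<^sub>R ?b x) = ?b"
    proof
      fix x :: 'a
      show "indicator (cball 0 r) x *\<^sub>R ?b x = ?b x"
        using supp[of x] by (cases "norm x > r") (auto simp: bump_def)
    qed
    ultimately show ?thesis by simp
  qed
  have "c \<noteq> 0"
  proof
    assume "c = 0"
    then have "AE x in lborel. ?b x = 0"
      using int integral_nonneg_eq_0_iff_AE[OF int] by (simp add: c_def bump_def)
    then have "AE x in lborel. x \<notin> ball (0::'a) r"
      by eventually_elim (use supp' in \<open>force simp: bump_def\<close>)
    then have "emeasure lborel (ball (0::'a) r) = 0"
      using AE_iff_null_sets[of "ball (0::'a) r" lborel] by (auto dest: null_setsD1)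
    then have "measure lborel (ball (0::'a) r) = 0" unfolding measure_def by simp
    then show False using content_ball_pos[OF r, of "0::'a"] by linarith
  qed
  moreover have "c \<ge> 0" unfolding c_def by (intro Bochner_Integration.integral_nonneg) (simp add: bump_def)
  ultimately have c: "c > 0" by simp
  show ?thesis
  proof
    show "((\<lambda>x. ?b x / c) has_derivative (\<lambda>h. (bump_grad r z /\<^sub>R c) \<bullet> h)) (at z)" for z
      using has_derivative_scaleR_right[OF D[of z], of "inverse c"]
      by (simp add: divide_inverse mult.commute)
    show "continuous_on UNIV (\<lambda>x. bump_grad r x /\<^sub>R c :: 'a)"
      unfolding bump_grad_def by (intro continuous_intros)
    show "integral\<^sup>L lborel (\<lambda>x. ?b x / c) = 1"
      using c by (simp add: c_def)
  qed (use c m0 in \<open>auto simp: bump_def bump_grad_def\<close>)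
qed


section \<open>The derivative of a mollified function of bounded variation\<close>

text \<open>The variation of \<open>f\<close> in the direction \<open>b\<close> is at most \<open>V\<close>; the function \<open>D\<close> is the gradient of
  the test function \<open>\<eta>\<close>.\<close>

definition variation_bound :: "('a::euclidean_space \<Rightarrow> real) \<Rightarrow> 'a \<Rightarrow> real \<Rightarrow> bool" where
  "variation_bound f b V \<longleftrightarrow> (\<forall>\<eta> D R.
     (\<forall>x. (\<eta> has_derivative (\<lambda>h. D x \<bullet> h)) (at x)) \<longrightarrow> continuous_on UNIV D \<longrightarrow>
     (\<forall>x. norm x > R \<longrightarrow> \<eta> x = 0) \<longrightarrow> (\<forall>x. \<bar>\<eta> x\<bar> \<le> 1) \<longrightarrow>
     (\<integral>x. f x * (D x \<bullet> b) \<partial>lborel) \<le> V)"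

text \<open>Fatou's lemma in the form in which it passes a uniform bound to a limit.\<close>

lemma nn_integral_le_of_AE_tendsto:
  fixes u :: "nat \<Rightarrow> 'a \<Rightarrow> ennreal"
  assumes [measurable]: "\<And>n. u n \<in> borel_measurable M" "v \<in> borel_measurable M"
    and "AE x in M. (\<lambda>n. u n x) \<longlonglongrightarrow> v x" and C: "\<And>n. (\<integral>\<^sup>+x. u n x \<partial>M) \<le> C"
  shows "(\<integral>\<^sup>+x. v x \<partial>M) \<le> C"
proof -
  have "(\<integral>\<^sup>+x. v x \<partial>M) = (\<integral>\<^sup>+x. liminf (\<lambda>n. u n x) \<partial>M)"
    using assms(3) by (intro nn_integral_cong_AE) (auto elim!: eventually_mono simp: lim_imp_Liminf)
  also have "\<dots> \<le> liminf (\<lambda>n. \<integral>\<^sup>+x. u n x \<partial>M)"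
    by (rule nn_integral_liminf) simp
  also have "\<dots> \<le> liminf (\<lambda>n. C)" by (intro Liminf_mono always_eventually allI C)
  finally show ?thesis by (simp add: Liminf_const)
qed

text \<open>The mollified function inherits the variation bound. Its derivative is paired with its own sign,
  cut off outside a ball. That function is not differentiable, but Fubini's theorem moves
  the mollification to it, and its mollification is an admissible test function.\<close>

lemma (in mollifier) nn_integral_partial_conv_le:
  assumes f: "integrable lborel f" and V: "variation_bound f b V"
  shows "(\<integral>\<^sup>+x. ennreal \<bar>conv f G x \<bullet> b\<bar> \<partial>lborel) \<le> ennreal V"
proof -
  define D where "D x = conv f G x \<bullet> b" for x
  have contD: "continuous_on UNIV D"
    unfolding D_def by (intro continuous_intros continuous_mollified_grad f)
  then have [measurable]: "D \<in> borel_measurable borel" by (rule borel_measurable_continuous_onI)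
  have [measurable]: "G \<in> borel_measurable borel" by (rule borel_measurable_continuous_onI[OF grad_continuous])
  have [measurable]: "f \<in> borel_measurable borel" using f by auto
  obtain K where K: "\<And>z. norm (G z) \<le> K" using grad_bounded by blast
  then have K0: "K \<ge> 0" using order_trans[OF norm_ge_zero] by blast
  have iG: "integrable lborel (\<lambda>y. g y *\<^sub>R G (x - y))" if "integrable lborel g" for g x
    by (rule integrable_conv_integrand[OF that grad_continuous K])
  have *: "(\<integral>\<^sup>+x. ennreal \<bar>D x\<bar> * indicator (cball 0 R) x \<partial>lborel) \<le> ennreal V" for R
  proof -
    \<comment> \<open>The cut-off makes the sign function integrable and its mollification compactly supported.\<close>
    define s where "s x = sgn (D x) * indicator (cball 0 R) x" for x
    have s1: "\<bar>s x\<bar> \<le> 1" for x by (auto simp: s_def indicator_def abs_sgn_eq)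
    have [measurable]: "s \<in> borel_measurable borel" unfolding s_def by (intro borel_measurable_times borel_measurable_indicator) auto
    have s: "integrable lborel s"
    proof (rule Bochner_Integration.integrable_bound)
      show "integrable lborel (indicator (cball 0 R :: 'a set) :: _ \<Rightarrow> real)"
        by (intro integrable_real_indicator) (use emeasure_lborel_cball_finite in \<open>auto simp: less_top\<close>)
    qed (auto simp: s_def indicator_def abs_sgn_eq)
    \<comment> \<open>The minus sign compensates the one that the odd gradient produces below.\<close>
    have "(\<integral>x. f x * ((- conv s G x) \<bullet> b) \<partial>lborel) \<le> V"
    proof (rule V[unfolded variation_bound_def, rule_format])
      show "((\<lambda>x. - conv s \<rho> x) has_derivative (\<lambda>h. (- conv s G x) \<bullet> h)) (at x)" for x
        using has_derivative_minus[OF mollified_has_derivative[OF s, of x]] by simp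
      show "continuous_on UNIV (\<lambda>x. - conv s G x)"
        by (intro continuous_intros continuous_mollified_grad s)
      show "- conv s \<rho> x = 0" if "R + r < norm x" for x
        using conv_support[of R s r \<rho> x] support that by (auto simp: s_def)
      show "\<bar>- conv s \<rho> x\<bar> \<le> 1" for x
        using abs_conv_le[of s 1 x] s1 by simp
    qed
    also have "(\<integral>x. f x * ((- conv s G x) \<bullet> b) \<partial>lborel) = (\<integral>x. \<integral>y. f x * (s y * (G (y - x) \<bullet> b)) \<partial>lborel \<partial>lborel)"
    proof (intro Bochner_Integration.integral_cong refl)
      fix x
      have "(- conv s G x) \<bullet> b = - (\<integral>y. s y * (G (x - y) \<bullet> b) \<partial>lborel)"
        using integral_inner_left[of b lborel "\<lambda>y. s y *\<^sub>R G (x - y)"] iG[OF s, of x]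
        by (simp add: conv_def)
      also have "\<dots> = (\<integral>y. s y * (G (y - x) \<bullet> b) \<partial>lborel)"
        using grad_odd[of "x - y" for y] by (simp flip: integral_minus)
      finally show "f x * ((- conv s G x) \<bullet> b) = (\<integral>y. f x * (s y * (G (y - x) \<bullet> b)) \<partial>lborel)"
        by simp
    qed
    also have "\<dots> = (\<integral>y. \<integral>x. f x * (s y * (G (y - x) \<bullet> b)) \<partial>lborel \<partial>lborel)"
    proof (rule lborel_pair.Fubini_integral[symmetric], rule integrableI_bounded)
      have "(\<integral>\<^sup>+z. ennreal (norm (case z of (x, y) \<Rightarrow> f x * (s y * (G (y - x) \<bullet> b)))) \<partial>(lborel \<Otimes>\<^sub>M lborel))
        \<le> (\<integral>\<^sup>+z. ennreal (K * norm b) * ennreal \<bar>f (fst z)\<bar> * ennreal \<bar>s (snd z)\<bar> \<partial>(lborel \<Otimes>\<^sub>M lborel))"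
      proof (rule nn_integral_mono, clarify)
        fix x y
        have "\<bar>G (y - x) \<bullet> b\<bar> \<le> K * norm b"
          using Cauchy_Schwarz_ineq2[of "G (y - x)" b] mult_right_mono[OF K[of "y - x"], of "norm b"] by simp
        then have "\<bar>f x\<bar> * (\<bar>s y\<bar> * \<bar>G (y - x) \<bullet> b\<bar>) \<le> \<bar>f x\<bar> * (\<bar>s y\<bar> * (K * norm b))"
          by (intro mult_left_mono) auto
        then show "ennreal (norm (f x * (s y * (G (y - x) \<bullet> b)))) \<le> ennreal (K * norm b) * ennreal \<bar>f (fst (x, y))\<bar> * ennreal \<bar>s (snd (x, y))\<bar>"
          using K0 by (auto simp: abs_mult ennreal_mult[symmetric] mult_ac intro!: ennreal_leI)
      qed
      also have "\<dots> = ennreal (K * norm b) * (\<integral>\<^sup>+x. ennreal \<bar>f x\<bar> \<partial>lborel) * (\<integral>\<^sup>+x. ennreal \<bar>s x\<bar> \<partial>lborel)"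
        by (subst lborel.nn_integral_fst[symmetric]) (auto simp: nn_integral_cmult nn_integral_multc)
      also have "\<dots> < \<infinity>"
        using f s by (auto simp: integrable_iff_bounded ennreal_mult_less_top)
      finally show "(\<integral>\<^sup>+z. ennreal (norm (case z of (x, y) \<Rightarrow> f x * (s y * (G (y - x) \<bullet> b)))) \<partial>(lborel \<Otimes>\<^sub>M lborel)) < \<infinity>" .
    qed measurable
    also have "\<dots> = (\<integral>y. \<bar>D y\<bar> * indicator (cball 0 R) y \<partial>lborel)"
    proof (intro Bochner_Integration.integral_cong refl)
      fix y
      have "(\<integral>x. f x * (s y * (G (y - x) \<bullet> b)) \<partial>lborel) = s y * (\<integral>x. f x * (G (y - x) \<bullet> b) \<partial>lborel)"
        by (simp only: mult.left_commute[of _ "s y"] integral_mult_right_zero)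
      also have "(\<integral>x. f x * (G (y - x) \<bullet> b) \<partial>lborel) = D y"
        using integral_inner_left[of b lborel "\<lambda>x. f x *\<^sub>R G (y - x)"] iG[OF f, of y]
        by (simp add: conv_def D_def)
      finally show "(\<integral>x. f x * (s y * (G (y - x) \<bullet> b)) \<partial>lborel) = \<bar>D y\<bar> * indicator (cball 0 R) y"
        by (simp add: s_def abs_sgn mult_ac)
    qed
    finally have le: "(\<integral>y. \<bar>D y\<bar> * indicator (cball 0 R) y \<partial>lborel) \<le> V" .
    have "integrable lborel (\<lambda>y. indicator (cball 0 R) y *\<^sub>R \<bar>D y\<bar>)"
      by (intro borel_integrable_compact continuous_intros continuous_on_subset[OF contD]) auto
    then have "(\<integral>\<^sup>+y. ennreal (\<bar>D y\<bar> * indicator (cball 0 R) y) \<partial>lborel) = ennreal (\<integral>y. \<bar>D y\<bar> * indicator (cball 0 R) y \<partial>lborel)"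
      by (intro nn_integral_eq_integral) (auto simp: mult.commute)
    with le show ?thesis by (simp add: ennreal_mult ennreal_indicator ennreal_leI)
  qed
  have "(\<integral>\<^sup>+x. ennreal \<bar>D x\<bar> \<partial>lborel) \<le> ennreal V"
  proof (rule nn_integral_le_of_AE_tendsto[OF _ _ _ *])
    show "AE x in lborel. (\<lambda>n. ennreal \<bar>D x\<bar> * indicator (cball 0 (real n)) x) \<longlonglongrightarrow> ennreal \<bar>D x\<bar>"
    proof (intro AE_I2 tendsto_eventually)
      fix x :: 'a
      show "eventually (\<lambda>n. ennreal \<bar>D x\<bar> * indicator (cball 0 (real n)) x = ennreal \<bar>D x\<bar>) sequentially"
        using eventually_ge_at_top[of "nat \<lceil>norm x\<rceil>"] by eventually_elim (auto simp: indicator_def nat_le_iff ceiling_le_iff)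
    qed
    show "(\<lambda>x. ennreal \<bar>D x\<bar> * indicator (cball 0 (real n)) x) \<in> borel_measurable lborel" for n
    proof -
      have [measurable]: "cball (0::'a) (real n) \<in> sets borel" by simp
      show ?thesis by measurable
    qed
  qed simp
  then show ?thesis by (simp add: D_def)
qed

section \<open>Convergence of mollifications in the mean\<close>

lemma integrable_continuous_compact_support:
  fixes g :: "'a::euclidean_space \<Rightarrow> real"
  assumes "continuous_on UNIV g" "\<And>x. norm x > R \<Longrightarrow> g x = 0"
  shows "integrable lborel g"
proof -
  have "integrable lborel (\<lambda>x. indicator (cball 0 R) x *\<^sub>R g x)"
    by (intro borel_integrable_compact continuous_on_subset[OF assms(1)]) auto
  moreover have "(\<lambda>x. indicator (cball 0 R) x *\<^sub>R g x) = g"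
    using assms(2) by (force simp: fun_eq_iff indicator_def)
  ultimately show ?thesis by simp
qed

text \<open>A mollification is a weighted mean of the values within distance \<open>r\<close>.\<close>

lemma (in mollifier) abs_conv_diff_le:
  assumes g: "integrable lborel g" and e: "\<And>y. norm (x - y) \<le> r \<Longrightarrow> \<bar>g y - g x\<bar> \<le> e"
    and "0 \<le> e"
  shows "\<bar>conv g \<rho> x - g x\<bar> \<le> e"
proof -
  have i: "integrable lborel (\<lambda>y. \<rho> (x - y))"
    by (rule lborel_integral_reflect(2)[OF measurable integrable])
  have 1: "(\<integral>y. \<rho> (x - y) \<partial>lborel) = 1"
    using lborel_integral_reflect(1)[OF measurable, of x] integral_1 by simp
  have "conv g \<rho> x - g x = (\<integral>y. (g y - g x) * \<rho> (x - y) \<partial>lborel)"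
    using i mollified_integrand_integrable[OF g, of x] 1 by (simp add: conv_def left_diff_distrib)
  also have "\<bar>\<dots>\<bar> \<le> (\<integral>y. e * \<rho> (x - y) \<partial>lborel)"
    unfolding real_norm_def[symmetric]
  proof (intro order_trans[OF integral_norm_bound] integral_mono_AE' AE_I2)
    fix y
    show "norm ((g y - g x) * \<rho> (x - y)) \<le> e * \<rho> (x - y)"
      using e[of y] support[of "x - y"] nonneg[of "x - y"]
      by (cases "norm (x - y) \<le> r") (auto simp: abs_mult intro!: mult_right_mono)
  qed (use i nonneg \<open>0 \<le> e\<close> in auto)
  finally show ?thesis using 1 by simp
qed

lemma (in mollifier) integrable_mollified:
  assumes g: "integrable lborel g"
  shows "integrable lborel (conv g \<rho>)"
proof (rule integrableI_bounded)
  show "conv g \<rho> \<in> borel_measurable lborel"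
    using borel_measurable_continuous_onI[OF continuous_mollified[OF g]] by simp
  have "(\<integral>\<^sup>+x. ennreal \<bar>g x\<bar> \<partial>lborel) < \<infinity>" using g by (simp add: integrable_iff_bounded)
  with nn_integral_abs_conv_le[OF g] show "(\<integral>\<^sup>+x. ennreal (norm (conv g \<rho> x)) \<partial>lborel) < \<infinity>"
    by (auto intro: le_less_trans)
qed

lemma (in mollifier) integral_abs_conv_le:
  assumes g: "integrable lborel g"
  shows "(\<integral>x. \<bar>conv g \<rho> x\<bar> \<partial>lborel) \<le> (\<integral>x. \<bar>g x\<bar> \<partial>lborel)"
  using nn_integral_abs_conv_le[OF g] g integrable_mollified[OF g]
  by (simp add: nn_integral_eq_integral)


definition moll :: "nat \<Rightarrow> 'a::euclidean_space \<Rightarrow> real" where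
  "moll n x = bump (1 / Suc n) x / integral\<^sup>L lborel (bump (1 / Suc n) :: 'a \<Rightarrow> real)"

definition moll_grad :: "nat \<Rightarrow> 'a::euclidean_space \<Rightarrow> 'a" where
  "moll_grad n x = bump_grad (1 / Suc n) x /\<^sub>R integral\<^sup>L lborel (bump (1 / Suc n) :: 'a \<Rightarrow> real)"

interpretation moll: mollifier "moll n" "moll_grad n" "1 / Suc n" for n
  unfolding moll_def[abs_def] moll_grad_def[abs_def] by (rule mollifier_bump) simp

lemma moll_conv_tendsto_continuous:
  fixes g :: "'a::euclidean_space \<Rightarrow> real"
  assumes c: "continuous_on UNIV g" and supp: "\<And>x. norm x > R \<Longrightarrow> g x = 0"
  shows "(\<lambda>n. \<integral>x. \<bar>conv g (moll n) x - g x\<bar> \<partial>lborel) \<longlonglongrightarrow> 0"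
proof -
  have g: "integrable lborel g" by (rule integrable_continuous_compact_support[OF c supp])
  obtain M where M: "\<And>x. \<bar>g x\<bar> \<le> M"
    using moll.compact_support_bounded[OF c supp] by auto
  have M0: "0 \<le> M" using order_trans[OF abs_ge_zero M] .
  have bound: "\<bar>conv g (moll n) x - g x\<bar> \<le> 2 * M * indicator (cball 0 (R + 1)) x" for n x
  proof (cases "norm x \<le> R + 1")
    case True
    have "\<bar>conv g (moll n) x - g x\<bar> \<le> 2 * M"
      using abs_triangle_ineq4[of "conv g (moll n) x" "g x"] moll.abs_conv_le[of g M n x, OF M] M[of x] by linarith
    then show ?thesis using True by simp
  next
    case False
    have "conv g (moll n) x = 0"
    proof (rule conv_support[of R g "1 / Suc n", OF supp])
      have "1 / Suc n \<le> (1::real)" by simp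
      then show "R + 1 / Suc n < norm x" using False by linarith
    qed (use moll.support in auto)
    then show ?thesis using False supp[of x] by simp
  qed
  have "(\<lambda>n. \<integral>x. \<bar>conv g (moll n) x - g x\<bar> \<partial>lborel) \<longlonglongrightarrow> (\<integral>x. 0 \<partial>(lborel :: 'a measure))"
  proof (rule integral_dominated_convergence)
    show "integrable lborel (\<lambda>x::'a. 2 * M * indicator (cball 0 (R + 1)) x)"
      by (intro integrable_mult_right integrable_real_indicator) (use emeasure_lborel_cball_finite in \<open>auto simp: less_top\<close>)
    show "(\<lambda>x. \<bar>conv g (moll n) x - g x\<bar>) \<in> borel_measurable lborel" for n
      using moll.integrable_mollified[OF g, of n] g by auto
    show "AE x in lborel. norm \<bar>conv g (moll n) x - g x\<bar> \<le> 2 * M * indicator (cball 0 (R + 1)) x" for n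
      using bound by simp
    show "AE x in lborel. (\<lambda>n. \<bar>conv g (moll n) x - g x\<bar>) \<longlonglongrightarrow> 0"
    proof (intro AE_I2 tendsto_rabs_zero LIMSEQ_I)
      fix x :: 'a and e :: real assume "0 < e"
      have "continuous (at x) g" using c by (simp add: continuous_on_eq_continuous_at)
      then obtain d where d: "d > 0" "\<And>y. dist y x < d \<Longrightarrow> dist (g y) (g x) < e / 2"
        using \<open>0 < e\<close> unfolding continuous_at_eps_delta by (metis half_gt_zero)
      obtain N where N: "1 / Suc N < d" using nat_approx_posE[OF d(1)] by auto
      show "\<exists>no. \<forall>n\<ge>no. norm (conv g (moll n) x - g x - 0) < e"
      proof (intro exI allI impI)
        fix n assume "N \<le> n"
        then have "1 / Suc n \<le> 1 / Suc N" by (simp add: frac_le)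
        have "\<bar>conv g (moll n) x - g x\<bar> \<le> e / 2"
        proof (rule moll.abs_conv_diff_le[OF g])
          fix y assume "norm (x - y) \<le> 1 / Suc n"
          then have "dist y x < d" using \<open>1 / Suc n \<le> 1 / Suc N\<close> N by (simp add: dist_norm norm_minus_commute)
          then show "\<bar>g y - g x\<bar> \<le> e / 2" using d(2) by (auto simp: dist_real_def less_imp_le)
        qed (use \<open>0 < e\<close> in auto)
        then show "norm (conv g (moll n) x - g x - 0) < e" using \<open>0 < e\<close> by simp
      qed
    qed
  qed simp
  then show ?thesis by simp
qed

text \<open>Continuous functions with compact support are dense in \<open>L\<^sup>1\<close>. The operation \<open>T M\<close> truncates
  values at height \<open>M\<close> and multiplies by a continuous cut-off function supported in the ball
  of radius \<open>M + 1\<close>. It preserves continuity, and the functions \<open>T M f\<close> converge to \<open>f\<close>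
  in the mean. A measurable function is the almost everywhere limit of continuous functions
  \<open>g k\<close>, and the functions \<open>T n (g k)\<close> are dominated, so they converge to \<open>T n f\<close> in the mean.\<close>

lemma integrable_approx_continuous:
  fixes f :: "'a::euclidean_space \<Rightarrow> real"
  assumes f: "integrable lborel f" and "0 < e"
  obtains g R where "continuous_on UNIV g" "\<And>x. norm x > R \<Longrightarrow> g x = 0"
    "(\<integral>x. \<bar>f x - g x\<bar> \<partial>lborel) < e"
proof -
  define T where "T M v x = max 0 (min 1 (M + 1 - norm x)) * max (- M) (min M v)" for M v :: real and x :: 'a
  have T_cont: "continuous_on UNIV (\<lambda>x. T M (h x) x)" if "continuous_on UNIV h" for h M
    unfolding T_def by (intro continuous_intros that)
  have T_le: "\<bar>T M v x\<bar> \<le> M * indicator (cball 0 (M + 1)) x" if "0 \<le> M" for M v x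
  proof -
    have "\<bar>T M v x\<bar> \<le> indicator (cball 0 (M + 1)) x * M"
      unfolding T_def abs_mult using that by (intro mult_mono) (auto simp: indicator_def)
    then show ?thesis by (simp add: mult.commute)
  qed
  have T_le': "\<bar>T M v x - v\<bar> \<le> 2 * \<bar>v\<bar>" if "0 \<le> M" for M v x
  proof -
    have "\<bar>T M v x\<bar> \<le> 1 * \<bar>v\<bar>"
      unfolding T_def abs_mult using that by (intro mult_mono) auto
    then show ?thesis by linarith
  qed
  have [measurable]: "f \<in> borel_measurable borel" using f by auto
  have T_meas: "(\<lambda>x. T M (f x) x) \<in> borel_measurable borel" for M
    unfolding T_def by measurable
  have "(\<lambda>n. \<integral>x. \<bar>T (real n) (f x) x - f x\<bar> \<partial>lborel) \<longlonglongrightarrow> (\<integral>x. 0 \<partial>(lborel :: 'a measure))"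
  proof (rule integral_dominated_convergence)
    show "integrable lborel (\<lambda>x. 2 * \<bar>f x\<bar>)" using f by auto
    show "AE x in lborel. norm \<bar>T (real n) (f x) x - f x\<bar> \<le> 2 * \<bar>f x\<bar>" for n
      using T_le' by simp
    show "AE x in lborel. (\<lambda>n. \<bar>T (real n) (f x) x - f x\<bar>) \<longlonglongrightarrow> 0"
    proof (intro AE_I2 tendsto_eventually)
      fix x
      show "eventually (\<lambda>n. \<bar>T (real n) (f x) x - f x\<bar> = 0) sequentially"
        using eventually_ge_at_top[of "nat \<lceil>max (norm x) \<bar>f x\<bar>\<rceil>"]
      proof eventually_elim
        case (elim n)
        then have "norm x \<le> n" "\<bar>f x\<bar> \<le> n" by linarith+
        then show ?case by (simp add: T_def)
      qed
    qed
  qed (use T_meas in auto)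
  then have "eventually (\<lambda>n. (\<integral>x. \<bar>T (real n) (f x) x - f x\<bar> \<partial>lborel) < e / 2) sequentially"
    using \<open>0 < e\<close> by (intro order_tendstoD) auto
  then obtain n where n: "(\<integral>x. \<bar>T (real n) (f x) x - f x\<bar> \<partial>lborel) < e / 2"
    by (auto simp: eventually_sequentially)
  have "f \<in> borel_measurable lebesgue"
    using f by (intro measurable_completion) auto
  then have "f measurable_on UNIV"
    by (rule lebesgue_measurable_imp_measurable_on_real) simp
  then obtain N g where N: "negligible N" and g: "\<And>k. continuous_on UNIV (g k)"
    and lim: "\<And>x. x \<notin> N \<Longrightarrow> (\<lambda>k. g k x) \<longlonglongrightarrow> f x"
    unfolding measurable_on_def by auto
  have int_g: "integrable lborel (\<lambda>x. T n (h x) x)" if "continuous_on UNIV h" for h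
    by (rule integrable_continuous_compact_support[OF T_cont[OF that], of "n + 1"]) (auto simp: T_def)
  have int_f: "integrable lborel (\<lambda>x. T n (f x) x)"
  proof (rule Bochner_Integration.integrable_bound[OF _ _ AE_I2])
    show "integrable lborel (\<lambda>x::'a. real n * indicator (cball 0 (real n + 1)) x)"
      by (intro integrable_mult_right integrable_real_indicator) (use emeasure_lborel_cball_finite in \<open>auto simp: less_top\<close>)
    show "norm (T n (f x) x) \<le> norm (real n * indicator (cball 0 (real n + 1)) x)" for x
      using T_le[of n "f x" x] by simp
  qed (use T_meas in auto)
  have "(\<lambda>k. \<integral>x. \<bar>T n (f x) x - T n (g k x) x\<bar> \<partial>lborel) \<longlonglongrightarrow> (\<integral>x. 0 \<partial>(lborel :: 'a measure))"
  proof (rule integral_dominated_convergence)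
    show "integrable lborel (\<lambda>x::'a. 2 * real n * indicator (cball 0 (real n + 1)) x)"
      by (intro integrable_mult_right integrable_real_indicator) (use emeasure_lborel_cball_finite in \<open>auto simp: less_top\<close>)
    show "AE x in lborel. norm \<bar>T n (f x) x - T n (g k x) x\<bar> \<le> 2 * real n * indicator (cball 0 (real n + 1)) x" for k
    proof (intro AE_I2)
      fix x
      show "norm \<bar>T n (f x) x - T n (g k x) x\<bar> \<le> 2 * real n * indicator (cball 0 (real n + 1)) x"
        using T_le[of n "f x" x] T_le[of n "g k x" x] by simp
    qed
    have "AE x in lebesgue. x \<notin> N"
      using N by (simp add: negligible_iff_null_sets AE_not_in)
    then have "AE x in lborel. x \<notin> N" by (simp add: AE_completion_iff)
    then show "AE x in lborel. (\<lambda>k. \<bar>T n (f x) x - T n (g k x) x\<bar>) \<longlonglongrightarrow> 0"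
    proof eventually_elim
      case (elim x)
      have "(\<lambda>k. \<bar>T n (f x) x - T n (g k x) x\<bar>) \<longlonglongrightarrow> \<bar>T n (f x) x - T n (f x) x\<bar>"
        unfolding T_def by (intro tendsto_intros lim elim)
      then show ?case by simp
    qed
    show "(\<lambda>x. \<bar>T n (f x) x - T n (g k x) x\<bar>) \<in> borel_measurable lborel" for k
      using int_f int_g[OF g, of k] by auto
  qed simp
  then have "eventually (\<lambda>k. (\<integral>x. \<bar>T n (f x) x - T n (g k x) x\<bar> \<partial>lborel) < e / 2) sequentially"
    using \<open>0 < e\<close> by (intro order_tendstoD) auto
  then obtain k where k: "(\<integral>x. \<bar>T n (f x) x - T n (g k x) x\<bar> \<partial>lborel) < e / 2"
    by (auto simp: eventually_sequentially)
  have "(\<integral>x. \<bar>f x - T n (g k x) x\<bar> \<partial>lborel) \<le>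
      (\<integral>x. \<bar>T n (f x) x - f x\<bar> + \<bar>T n (f x) x - T n (g k x) x\<bar> \<partial>lborel)"
    using f int_f int_g[OF g, of k] by (intro integral_mono) auto
  also have "\<dots> = (\<integral>x. \<bar>T n (f x) x - f x\<bar> \<partial>lborel) + (\<integral>x. \<bar>T n (f x) x - T n (g k x) x\<bar> \<partial>lborel)"
    using f int_f int_g[OF g, of k] by (intro Bochner_Integration.integral_add) auto
  finally have "(\<integral>x. \<bar>f x - T n (g k x) x\<bar> \<partial>lborel) < e" using n k by linarith
  then show ?thesis
    by (rule that[of "\<lambda>x. T n (g k x) x" "n + 1", OF T_cont[OF g], rotated]) (auto simp: T_def)
qed

text \<open>The set of \<open>f\<close> with this property is closed in \<open>L\<^sup>1\<close>, as mollification is a contraction, and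
  it contains the continuous functions with compact support.\<close>

lemma moll_conv_tendsto:
  fixes f :: "'a::euclidean_space \<Rightarrow> real"
  assumes f: "integrable lborel f"
  shows "(\<lambda>n. \<integral>x. \<bar>conv f (moll n) x - f x\<bar> \<partial>lborel) \<longlonglongrightarrow> 0"
proof (rule LIMSEQ_I)
  fix e :: real assume "0 < e"
  then obtain g R where g: "continuous_on UNIV g" "\<And>x. norm x > R \<Longrightarrow> g x = 0"
    and fg: "(\<integral>x. \<bar>f x - g x\<bar> \<partial>lborel) < e / 3"
    using integrable_approx_continuous[OF f, of "e / 3"] by auto
  have ig: "integrable lborel g" by (rule integrable_continuous_compact_support[OF g])
  have "eventually (\<lambda>n. (\<integral>x. \<bar>conv g (moll n) x - g x\<bar> \<partial>lborel) < e / 3) sequentially"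
    using moll_conv_tendsto_continuous[OF g] \<open>0 < e\<close> by (intro order_tendstoD) auto
  then obtain N where N: "\<And>n. n \<ge> N \<Longrightarrow> (\<integral>x. \<bar>conv g (moll n) x - g x\<bar> \<partial>lborel) < e / 3"
    by (auto simp: eventually_sequentially)
  have "(\<integral>x. \<bar>conv f (moll n) x - f x\<bar> \<partial>lborel) < e" if "n \<ge> N" for n
  proof -
    define h where "h x = f x - g x" for x
    have h: "integrable lborel h" using f ig unfolding h_def by (rule Bochner_Integration.integrable_diff)
    have *: "conv h (moll n) x = conv f (moll n) x - conv g (moll n) x" for x
      using moll.mollified_integrand_integrable[OF f, of n x] moll.mollified_integrand_integrable[OF ig, of n x]
      by (simp add: conv_def h_def left_diff_distrib)
    have i: "integrable lborel (\<lambda>x. \<bar>conv h (moll n) x\<bar>)" "integrable lborel (\<lambda>x. \<bar>conv g (moll n) x - g x\<bar>)" "integrable lborel (\<lambda>x. \<bar>h x\<bar>)"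
      using moll.integrable_mollified[OF h, of n] moll.integrable_mollified[OF ig, of n] ig h by auto
    have "(\<integral>x. \<bar>conv f (moll n) x - f x\<bar> \<partial>lborel) \<le>
      (\<integral>x. \<bar>conv h (moll n) x\<bar> + \<bar>conv g (moll n) x - g x\<bar> + \<bar>h x\<bar> \<partial>lborel)"
      using i f moll.integrable_mollified[OF f, of n]
      by (intro integral_mono Bochner_Integration.integrable_add) (auto simp: * h_def)
    also have "\<dots> = (\<integral>x. \<bar>conv h (moll n) x\<bar> \<partial>lborel) + (\<integral>x. \<bar>conv g (moll n) x - g x\<bar> \<partial>lborel) + (\<integral>x. \<bar>h x\<bar> \<partial>lborel)"
      using i by simp
    also have "(\<integral>x. \<bar>conv h (moll n) x\<bar> \<partial>lborel) \<le> (\<integral>x. \<bar>h x\<bar> \<partial>lborel)"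
      by (rule moll.integral_abs_conv_le[OF h])
    finally show ?thesis using N[OF that] fg by (simp add: h_def)
  qed
  then show "\<exists>no. \<forall>n\<ge>no. norm ((\<integral>x. \<bar>conv f (moll n) x - f x\<bar> \<partial>lborel) - 0) < e"
    by auto
qed

section \<open>Sobolev's inequality for functions of bounded variation\<close>

lemma abs_le_nn_integral_abs_deriv:
  fixes \<phi> \<phi>' :: "real \<Rightarrow> real"
  assumes D: "\<And>t. (\<phi> has_real_derivative \<phi>' t) (at t)" and cont: "continuous_on UNIV \<phi>'"
    and lim: "(\<lambda>n. \<phi> (- real n)) \<longlonglongrightarrow> 0"
  shows "ennreal \<bar>\<phi> s\<bar> \<le> (\<integral>\<^sup>+t. ennreal \<bar>\<phi>' t\<bar> \<partial>lborel)"
proof (rule tendsto_upperbound)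
  show "(\<lambda>n. ennreal \<bar>\<phi> s - \<phi> (- real n)\<bar>) \<longlonglongrightarrow> ennreal \<bar>\<phi> s\<bar>"
    using tendsto_diff[OF tendsto_const lim, of "\<phi> s"] by (intro tendsto_ennrealI tendsto_rabs) simp
  show "\<forall>\<^sub>F n in sequentially. ennreal \<bar>\<phi> s - \<phi> (- real n)\<bar> \<le> (\<integral>\<^sup>+t. ennreal \<bar>\<phi>' t\<bar> \<partial>lborel)"
    using eventually_ge_at_top[of "nat \<lceil>- s\<rceil>"]
  proof eventually_elim
    case (elim n)
    then have "- real n \<le> s" by linarith
    then have "has_bochner_integral lborel (\<lambda>t. \<phi>' t * indicator {- real n .. s} t) (\<phi> s - \<phi> (- real n))"
      using D cont by (intro has_bochner_integral_FTC_Icc_real) (auto simp: continuous_on_eq_continuous_at)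
    then have "ennreal (norm (\<phi> s - \<phi> (- real n))) \<le> (\<integral>\<^sup>+t. ennreal (norm (\<phi>' t * indicator {- real n .. s} t)) \<partial>lborel)"
      using integral_norm_bound_ennreal by (metis has_bochner_integral_iff)
    also have "\<dots> \<le> (\<integral>\<^sup>+t. ennreal \<bar>\<phi>' t\<bar> \<partial>lborel)"
      by (intro nn_integral_mono ennreal_leI) (auto simp: indicator_def)
    finally show ?case by simp
  qed
qed simp

text \<open>As the mollified function vanishes at infinity, its value at a point of a line is the integral
  of its derivative over the half-line that ends there. The point \<open>x\<close> has parameter \<open>c\<close>.\<close>

lemma (in mollifier) abs_mollified_le_line_integral:
  fixes x a :: 'a
  assumes f: "integrable lborel f" and a: "norm a = 1"
  shows "ennreal \<bar>conv f \<rho> x\<bar> \<le> (\<integral>\<^sup>+t. ennreal \<bar>conv f G (x + (t - c) *\<^sub>R a) \<bullet> a\<bar> \<partial>lborel)"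
proof -
  define L where "L t = x + (t - c) *\<^sub>R a" for t
  have "((\<lambda>t. conv f \<rho> (L t)) has_real_derivative (conv f G (L t) \<bullet> a)) (at t)" for t
  proof -
    have "(L has_derivative (\<lambda>h. h *\<^sub>R a)) (at t)"
      unfolding L_def by (auto intro!: derivative_eq_intros)
    from has_derivative_compose[OF this mollified_has_derivative[OF f]] show ?thesis
      by (simp add: has_field_derivative_def mult.commute[of _ "conv f G (L t) \<bullet> a"])
  qed
  moreover have "continuous_on UNIV (\<lambda>t. conv f G (L t) \<bullet> a)"
    unfolding L_def
    by (intro continuous_intros continuous_on_compose2[OF continuous_mollified_grad[OF f]]) auto
  moreover have "(\<lambda>n. conv f \<rho> (L (- real n))) \<longlonglongrightarrow> 0"
  proof -
    obtain K where "\<And>z. \<bar>\<rho> z\<bar> \<le> K" using bounded by blast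
    moreover have "filterlim (\<lambda>n. L (- real n)) at_infinity sequentially"
    proof (rule filterlim_norm_at_top_imp_at_infinity, rule filterlim_at_top_mono)
      show "filterlim (\<lambda>n. (- \<bar>c\<bar> - norm x) + real n) at_top sequentially"
        by (rule filterlim_tendsto_add_at_top[OF tendsto_const filterlim_real_sequentially])
      have "(- \<bar>c\<bar> - norm x) + real n \<le> norm (L (- real n))" for n
      proof -
        have "norm ((- real n - c) *\<^sub>R a) = \<bar>- real n - c\<bar>" using a by simp
        moreover have "norm ((- real n - c) *\<^sub>R a) \<le> norm (L (- real n)) + norm x"
          using norm_triangle_ineq4[of "L (- real n)" x] by (simp add: L_def)
        ultimately show ?thesis by linarith
      qed
      then show "\<forall>\<^sub>F n in sequentially. (- \<bar>c\<bar> - norm x) + real n \<le> norm (L (- real n))" by simp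
    qed
    ultimately show ?thesis
      by (intro conv_tendsto_0_at_infinity[OF f continuous, of K r]) (auto intro: support)
  qed
  ultimately have "ennreal \<bar>conv f \<rho> (L c)\<bar> \<le> (\<integral>\<^sup>+t. ennreal \<bar>conv f G (L t) \<bullet> a\<bar> \<partial>lborel)"
    by (rule abs_le_nn_integral_abs_deriv)
  then show ?thesis by (simp add: L_def)
qed

text \<open>Since \<open>m = CARD('n) - 1\<close>, the power on the left is \<open>\<bar>u\<bar> powr (d / (d - 1))\<close> for
  \<open>u = conv f \<rho>\<close> and \<open>d = CARD('n)\<close>.\<close>

lemma sobolev_mollified:
  fixes f :: "real^'n::finite \<Rightarrow> real"
  assumes m: "m = CARD('n) - 1" "0 < m"
    and "mollifier \<rho> G r" and f: "integrable lborel f"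
    and V: "\<And>i. variation_bound f (axis i 1) V"
  shows "(\<integral>\<^sup>+x. eroot m (ennreal \<bar>conv f \<rho> x\<bar>) ^ CARD('n) \<partial>lborel)
    \<le> eroot m (of_nat CARD('n) * ennreal V) ^ CARD('n)"
proof -
  interpret mollifier \<rho> G r by fact
  define F where "F x = (\<Sum>i\<in>UNIV. ennreal \<bar>conv f G x \<bullet> axis i 1\<bar>)" for x
  have [measurable]: "conv f G \<in> borel_measurable borel"
    by (rule borel_measurable_continuous_onI[OF continuous_mollified_grad[OF f]])
  have F_meas [measurable]: "F \<in> borel_measurable borel" unfolding F_def by measurable
  have "ennreal \<bar>conv f \<rho> x\<bar> \<le> (\<integral>\<^sup>+t. F (x + (t - x $ k) *\<^sub>R axis k 1) \<partial>lborel)" for x k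
  proof -
    have "ennreal \<bar>conv f \<rho> x\<bar> \<le> (\<integral>\<^sup>+t. ennreal \<bar>conv f G (x + (t - x $ k) *\<^sub>R axis k 1) \<bullet> axis k 1\<bar> \<partial>lborel)"
      by (rule abs_mollified_le_line_integral[OF f]) simp
    also have "\<dots> \<le> (\<integral>\<^sup>+t. F (x + (t - x $ k) *\<^sub>R axis k 1) \<partial>lborel)"
      unfolding F_def by (intro nn_integral_mono member_le_sum) auto
    finally show ?thesis .
  qed
  then have "(\<integral>\<^sup>+x. (\<Prod>k\<in>(UNIV::'n set). eroot m (ennreal \<bar>conv f \<rho> x\<bar>)) \<partial>lborel)
     \<le> (\<integral>\<^sup>+x. (\<Prod>k\<in>UNIV. eroot m (\<integral>\<^sup>+t. F (x + (t - x $ k) *\<^sub>R axis k 1) \<partial>lborel)) \<partial>lborel)"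
    using m by (intro nn_integral_mono prod_mono_ennreal eroot_mono) auto
  also have "\<dots> \<le> eroot m (\<integral>\<^sup>+x. F x \<partial>lborel) ^ CARD('n)"
    by (rule gagliardo_inequality[OF m F_meas])
  also have "(\<integral>\<^sup>+x. F x \<partial>lborel) = (\<Sum>i\<in>(UNIV::'n set). \<integral>\<^sup>+x. ennreal \<bar>conv f G x \<bullet> axis i 1\<bar> \<partial>lborel)"
    unfolding F_def by (intro nn_integral_sum) measurable
  also have "\<dots> \<le> (\<Sum>i\<in>(UNIV::'n set). ennreal V)"
    by (intro sum_mono nn_integral_partial_conv_le[OF f V])
  finally show ?thesis
    using m by (simp add: power_mono eroot_mono)
qed

lemma sobolev_borel:
  fixes f :: "real^'n::finite \<Rightarrow> real"
  assumes m: "m = CARD('n) - 1" "0 < m" and f: "integrable lborel f"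
    and V: "\<And>i. variation_bound f (axis i 1) V"
  shows "(\<integral>\<^sup>+x. eroot m (ennreal \<bar>f x\<bar>) ^ CARD('n) \<partial>lborel)
    \<le> eroot m (of_nat CARD('n) * ennreal V) ^ CARD('n)"
proof -
  have [measurable]: "f \<in> borel_measurable borel" using f by auto
  have i: "integrable lborel (\<lambda>x. conv f (moll n) x - f x)" for n
    using moll.integrable_mollified[OF f, of n] f by auto
  from tendsto_L1_AE_subseq[of lborel "\<lambda>n x. conv f (moll n) x - f x", OF i] moll_conv_tendsto[OF f]
  obtain s where s: "AE x in lborel. (\<lambda>n. conv f (moll (s n)) x - f x) \<longlonglongrightarrow> 0"
    by auto
  show ?thesis
  proof (rule nn_integral_le_of_AE_tendsto)
    show "(\<integral>\<^sup>+x. eroot m (ennreal \<bar>conv f (moll (s n)) x\<bar>) ^ CARD('n) \<partial>lborel)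
      \<le> eroot m (of_nat CARD('n) * ennreal V) ^ CARD('n)" for n
      by (rule sobolev_mollified[OF m moll.mollifier_axioms f V])
    show "(\<lambda>x. eroot m (ennreal \<bar>conv f (moll (s n)) x\<bar>) ^ CARD('n)) \<in> borel_measurable lborel" for n
      using moll.integrable_mollified[OF f, of "s n"] by (auto dest!: borel_measurable_integrable)
    show "AE x in lborel. (\<lambda>n. eroot m (ennreal \<bar>conv f (moll (s n)) x\<bar>) ^ CARD('n)) \<longlonglongrightarrow> eroot m (ennreal \<bar>f x\<bar>) ^ CARD('n)"
      using s
    proof eventually_elim
      case (elim x)
      then have "(\<lambda>n. conv f (moll (s n)) x) \<longlonglongrightarrow> f x" by (simp add: LIM_zero_iff)
      then have "(\<lambda>n. ennreal (root m \<bar>conv f (moll (s n)) x\<bar> ^ CARD('n))) \<longlonglongrightarrow> ennreal (root m \<bar>f x\<bar> ^ CARD('n))"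
        by (intro tendsto_intros)
      then show ?case by (simp add: ennreal_power real_root_ge_zero)
    qed
  qed simp
qed


section \<open>Test fields on which the potential cancels\<close>

lemma partial_deriv_eq:
  assumes "(g has_derivative (\<lambda>h. D \<bullet> h)) (at x)"
  shows "partial_deriv i g x = D \<bullet> axis i 1"
proof -
  have "((\<lambda>t. x + t *\<^sub>R axis i 1) has_derivative (\<lambda>h. h *\<^sub>R axis i 1)) (at (0::real))"
    by (auto intro!: derivative_eq_intros)
  from has_derivative_compose[OF this, of g "\<lambda>h. D \<bullet> h"] assms
  have "((\<lambda>t. g (x + t *\<^sub>R axis i 1)) has_real_derivative (D \<bullet> axis i 1)) (at 0)"
    by (simp add: has_field_derivative_def mult.commute[of _ "D \<bullet> axis i 1"])
  then show ?thesis unfolding partial_deriv_def by (rule DERIV_imp_deriv)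
qed

text \<open>The factor \<open>1/2\<close> makes the Hermite divergence exactly \<open>\<partial>\<^sub>i \<eta>\<close>, and leaves the norm at most
  \<open>\<bar>\<eta>\<bar>\<close>.\<close>

definition diagonal_field :: "'n::finite \<Rightarrow> (real^'n \<Rightarrow> real) \<Rightarrow> real^'n \<Rightarrow> real^('n + 'n)" where
  "diagonal_field i \<eta> x = \<eta> x *\<^sub>R ((1/2) *\<^sub>R (axis (Inl i) 1 + axis (Inr i) 1))"

lemma diagonal_field_in_test_fields:
  fixes \<eta> :: "real^'n::finite \<Rightarrow> real"
  assumes D: "\<And>x. (\<eta> has_derivative (\<lambda>h. D x \<bullet> h)) (at x)" "continuous_on UNIV D"
    and supp: "\<And>x. norm x > R \<Longrightarrow> \<eta> x = 0" and le: "\<And>x. \<bar>\<eta> x\<bar> \<le> 1"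
  shows "diagonal_field i \<eta> \<in> test_fields"
proof -
  define w :: "real^('n + 'n)" where "w = (1/2) *\<^sub>R (axis (Inl i) 1 + axis (Inr i) 1)"
  have w: "norm w \<le> 1"
    using norm_triangle_ineq[of "axis (Inl i) 1 :: real^('n + 'n)" "axis (Inr i) 1"] by (simp add: w_def)
  have field: "diagonal_field i \<eta> = (\<lambda>x. \<eta> x *\<^sub>R w)"
    by (simp add: fun_eq_iff diagonal_field_def w_def)
  define \<phi>' where "\<phi>' x = blinfun_scaleR_left w o\<^sub>L blinfun_inner_right (D x)" for x
  have "(diagonal_field i \<eta> has_derivative blinfun_apply (\<phi>' x)) (at x)" for x
    using has_derivative_scaleR_left[OF D(1)[of x], of w]
    by (simp add: field \<phi>'_def blinfun_compose.rep_eq o_def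
        blinfun_scaleR_left.rep_eq blinfun_inner_right.rep_eq)
  moreover have "continuous_on UNIV \<phi>'"
    unfolding \<phi>'_def by (intro continuous_intros bounded_linear.continuous_on[OF bounded_linear_blinfun_inner_right] D)
  moreover have "compact (closure {x. diagonal_field i \<eta> x \<noteq> 0})"
  proof -
    have "{x. diagonal_field i \<eta> x \<noteq> 0} \<subseteq> cball 0 R"
      using supp by (force simp: diagonal_field_def)
    then show ?thesis by (auto intro: bounded_subset)
  qed
  moreover have "norm (diagonal_field i \<eta> x) \<le> 1" for x
    using mult_mono[OF le[of x] w] by (simp add: field)
  ultimately show ?thesis by (auto simp: test_fields_def C1_fun_def)
qed

text \<open>The two components carry the same function, so \<open>hermite_potential\<close> enters once with each sign.\<close>

lemma hermite_div_diagonal_field: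
  fixes \<eta> :: "real^'n::finite \<Rightarrow> real"
  assumes D: "\<And>x. (\<eta> has_derivative (\<lambda>h. D x \<bullet> h)) (at x)"
  shows "hermite_div \<alpha> (diagonal_field i \<eta>) x = D x \<bullet> axis i 1"
proof -
  have comp: "(\<lambda>y. diagonal_field i \<eta> y $ Inl k) = (\<lambda>y. (if k = i then 1/2 else 0) * \<eta> y)"
    "(\<lambda>y. diagonal_field i \<eta> y $ Inr k) = (\<lambda>y. (if k = i then 1/2 else 0) * \<eta> y)" for k
    by (auto simp: diagonal_field_def axis_def)
  have pd: "partial_deriv k (\<lambda>y. (if k = i then 1/2 else 0) * \<eta> y) x = (if k = i then (D x \<bullet> axis i 1) / 2 else 0)" for k
    using partial_deriv_eq[of "\<lambda>y. c * \<eta> y" "c *\<^sub>R D x" x k for c] has_derivative_mult_right[OF D, of _ x]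
    by simp
  have "hermite_div \<alpha> (diagonal_field i \<eta>) x = (\<Sum>k\<in>UNIV. if k = i then D x \<bullet> axis i 1 else 0)"
    unfolding hermite_div_def A_plus_def A_minus_def comp pd sum.distrib[symmetric]
    by (intro sum.cong) auto
  then show ?thesis by simp
qed

lemma hermite_variation_ge_partial:
  fixes f :: "real^'n::finite \<Rightarrow> real"
  assumes D: "\<And>x. (\<eta> has_derivative (\<lambda>h. D x \<bullet> h)) (at x)" "continuous_on UNIV D"
    and supp: "\<And>x. norm x > R \<Longrightarrow> \<eta> x = 0" and le: "\<And>x. \<bar>\<eta> x\<bar> \<le> 1"
  shows "ereal (LINT x|lebesgue. f x * (D x \<bullet> axis i 1)) \<le> hermite_variation \<alpha> f"
proof -
  have "ereal (LINT x|lebesgue. f x * hermite_div \<alpha> (diagonal_field i \<eta>) x) \<le> hermite_variation \<alpha> f"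
    unfolding hermite_variation_def
    by (rule SUP_upper) (rule diagonal_field_in_test_fields[OF assms])
  then show ?thesis by (simp add: hermite_div_diagonal_field[OF D(1)])
qed

lemma hermite_variation_nonneg: "0 \<le> hermite_variation \<alpha> f"
  using hermite_variation_ge_partial[of "\<lambda>_. 0" "\<lambda>_. 0" 0 f] by (simp add: zero_ereal_def)


section \<open>The Hermite inequalities\<close>

lemma powr_eq_root_power:
  assumes "0 \<le> a" "2 \<le> n"
  shows "a powr (real n / (real n - 1)) = root (n - 1) a ^ n"
proof (cases "a = 0")
  case False
  then have "root (n - 1) a ^ n = (a powr (1 / real (n - 1))) powr real n"
    using assms by (subst powr_realpow) (auto simp: root_powr_inverse)
  also have "\<dots> = a powr (real n / (real n - 1))"
    using assms by (simp add: powr_powr of_nat_diff)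
  finally show ?thesis by simp
qed (use assms in auto)

text \<open>A Borel representative \<open>g\<close> of \<open>f\<close> is used, because \<open>sobolev_borel\<close> rests on
  Fubini's theorem for Borel functions.\<close>

lemma sobolev_hermite:
  fixes f :: "real^'n::finite \<Rightarrow> real"
  assumes d: "CARD('n) \<ge> 2" and f: "f \<in> hermite_BV \<alpha>"
  shows "Lp_norm (real CARD('n) / (real CARD('n) - 1)) f \<le> ereal (real CARD('n)) * hermite_variation \<alpha> f"
proof -
  define n where "n = CARD('n)"
  define p where "p = real n / (real n - 1)"
  have n: "2 \<le> n" and p: "0 < p" using d by (auto simp: n_def p_def)
  obtain V where V: "hermite_variation \<alpha> f = ereal V" "0 \<le> V"
    using f hermite_variation_nonneg[of \<alpha> f] by (cases "hermite_variation \<alpha> f") (auto simp: hermite_BV_def)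
  have f_int: "integrable lebesgue f" using f by (simp add: hermite_BV_def)
  then obtain g where g [measurable]: "g \<in> borel_measurable lborel" and fg: "AE x in lborel. f x = g x"
    using completion_ex_borel_measurable_real[of f lborel] by auto
  have fg': "AE x in lebesgue. f x = g x" using fg by (rule AE_completion)
  have [measurable]: "f \<in> borel_measurable lebesgue" "g \<in> borel_measurable lebesgue"
    using f_int g by (auto intro: measurable_completion)
  have g_int: "integrable lborel g"
    using f_int fg' integrable_cong_AE[of f lebesgue g] by (simp add: integrable_completion)
  have "variation_bound g (axis i 1) V" for i
    unfolding variation_bound_def
  proof (intro allI impI)
    fix \<eta> and D :: "real^'n \<Rightarrow> real^'n" and R
    assume D: "\<forall>x. (\<eta> has_derivative (\<bullet>) (D x)) (at x)" "continuous_on UNIV D"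
      and *: "\<forall>x. R < norm x \<longrightarrow> \<eta> x = 0" "\<forall>x. \<bar>\<eta> x\<bar> \<le> 1"
    have [measurable]: "D \<in> borel_measurable borel" by (rule borel_measurable_continuous_onI[OF D(2)])
    then have D_leb [measurable]: "D \<in> borel_measurable lebesgue" by (auto intro: measurable_completion)
    have "(LINT x|lebesgue. f x * (D x \<bullet> axis i 1)) = (LINT x|lebesgue. g x * (D x \<bullet> axis i 1))"
      using fg' by (intro integral_cong_AE) auto
    also have "\<dots> = (\<integral>x. g x * (D x \<bullet> axis i 1) \<partial>lborel)"
      by (rule integral_completion) measurable
    finally have "(\<integral>x. g x * (D x \<bullet> axis i 1) \<partial>lborel) = (LINT x|lebesgue. f x * (D x \<bullet> axis i 1))" by simp
    then show "(\<integral>x. g x * (D x \<bullet> axis i 1) \<partial>lborel) \<le> V"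
      using hermite_variation_ge_partial[of \<eta> D R f i \<alpha>] D * V(1) by simp
  qed
  then have "(\<integral>\<^sup>+x. eroot (n - 1) (ennreal \<bar>g x\<bar>) ^ n \<partial>lborel) \<le> eroot (n - 1) (of_nat n * ennreal V) ^ n"
    using n g_int unfolding n_def by (intro sobolev_borel) auto
  also have "\<dots> = ennreal ((n * V) powr p)"
    using V(2) n by (simp add: p_def powr_eq_root_power ennreal_power real_root_ge_zero
        ennreal_mult[symmetric] ennreal_of_nat_eq_real_of_nat)
  also have "(\<integral>\<^sup>+x. eroot (n - 1) (ennreal \<bar>g x\<bar>) ^ n \<partial>lborel) = (\<integral>\<^sup>+x. ennreal (\<bar>g x\<bar> powr p) \<partial>lborel)"
    using n by (simp add: p_def powr_eq_root_power ennreal_power real_root_ge_zero)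
  also have "\<dots> = (\<integral>\<^sup>+x. ennreal (\<bar>f x\<bar> powr p) \<partial>lebesgue)"
    unfolding nn_integral_completion using fg by (intro nn_integral_cong_AE) auto
  finally have I: "(\<integral>\<^sup>+x. ennreal (\<bar>f x\<bar> powr p) \<partial>lebesgue) \<le> ennreal ((n * V) powr p)" .
  then have fin: "(\<integral>\<^sup>+x. ennreal (\<bar>f x\<bar> powr p) \<partial>lebesgue) \<noteq> \<infinity>" by (auto simp: top_unique)
  have "enn2real (\<integral>\<^sup>+x. ennreal (\<bar>f x\<bar> powr p) \<partial>lebesgue) powr (1 / p) \<le> ((n * V) powr p) powr (1 / p)"
    using enn2real_mono[OF I] p by (intro powr_mono2) auto
  also have "\<dots> = n * V" using p V(2) by (simp add: powr_powr)
  finally have "Lp_norm p f \<le> ereal (n * V)" using fin by (simp add: Lp_norm_def)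
  then show ?thesis using V by (simp add: p_def n_def)
qed

lemma sobolev_inequality_hermite:
  assumes "CARD('n::finite) \<ge> 2"
  shows "sobolev_inequality TYPE('n) \<alpha>"
  unfolding sobolev_inequality_def
  using sobolev_hermite[where 'n='n] assms by (intro exI[of _ "real CARD('n)"]) auto

lemma hermite_variation_indicator: "hermite_variation \<alpha> (indicator E) = hermite_perimeter \<alpha> E"
  by (simp add: hermite_variation_def hermite_perimeter_def set_lebesgue_integral_def)

text \<open>The perimeter of a set is the variation of its indicator function \<open>\<chi>\<close>, and \<open>\<bar>\<chi>\<bar> powr p = \<chi>\<close>.\<close>

lemma isoperimetric_if_sobolev:
  assumes d: "CARD('n::finite) \<ge> 2" and "sobolev_inequality TYPE('n) \<alpha>"
  shows "isoperimetric_inequality TYPE('n) \<alpha>"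
proof -
  define p where "p = real CARD('n) / (real CARD('n) - 1)"
  have p: "0 < p" "1 / p = 1 - 1 / real CARD('n)" using d by (auto simp: p_def field_simps)
  from assms obtain c where c: "c > 0"
    "\<And>f. f \<in> (hermite_BV \<alpha> :: (real^'n \<Rightarrow> real) set) \<Longrightarrow> Lp_norm p f \<le> ereal c * hermite_variation \<alpha> f"
    unfolding sobolev_inequality_def p_def by blast
  show ?thesis unfolding isoperimetric_inequality_def
  proof (intro exI[of _ c] conjI allI impI c(1))
    fix E :: "(real^'n) set"
    assume E: "E \<in> sets lebesgue" "bounded E" "hermite_perimeter \<alpha> E < \<infinity>"
    then have E': "E \<in> lmeasurable" by (simp add: bounded_set_imp_lmeasurable)
    then have "(indicator E :: real^'n \<Rightarrow> real) \<in> hermite_BV \<alpha>"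
      using E by (auto simp: hermite_BV_def hermite_variation_indicator fmeasurable_def)
    then have "Lp_norm p (indicator E) \<le> ereal c * hermite_perimeter \<alpha> E"
      using c(2)[of "indicator E"] by (simp add: hermite_variation_indicator)
    moreover have "Lp_norm p (indicator E) = ereal (measure lebesgue E powr (1 / p))"
    proof -
      have "(\<lambda>x. ennreal (\<bar>indicator E x\<bar> powr p)) = indicator E"
        using p(1) by (auto simp: fun_eq_iff indicator_def)
      moreover have "emeasure lebesgue E \<noteq> \<infinity>" using E' by (auto simp: fmeasurable_def)
      ultimately show ?thesis using E by (simp add: Lp_norm_def measure_def)
    qed
    ultimately show "ereal (measure lebesgue E powr (1 - 1 / real CARD('n))) \<le> ereal c * hermite_perimeter \<alpha> E"
      using p(2) by simp
  qed
qed

theorem theorem1p11: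
  fixes \<alpha> :: real
  assumes "CARD('n::finite) \<ge> 2" and "\<alpha> \<ge> 1"
  shows "sobolev_inequality TYPE('n) \<alpha> \<and>
         isoperimetric_inequality TYPE('n) \<alpha> \<and>
         (sobolev_inequality TYPE('n) \<alpha> \<longleftrightarrow> isoperimetric_inequality TYPE('n) \<alpha>)"
  using sobolev_inequality_hermite[OF assms(1)] isoperimetric_if_sobolev[OF assms(1)] by blast

end
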